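(* Let $h$ be the Klein metric on the unit disk $\mathbb{D}^2=\{(x,y)\in\mathbb{R}^2:x^2+y^2<1\}$, i.e. the Riemannian metric with $$h(\mathbf y,\mathbf y)=\frac{(u^2+v^2)-(xv-yu)^2}{(1-x^2-y^2)^2},\qquad \mathbf y=u\frac{\partial}{\partial x}+v\frac{\partial}{\partial y}\in T_{(x,y)}\mathbb{D}^2.$$ Let $\mathbf{u}=(1-x^2-y^2)\big(x\frac{\partial}{\partial x}+y\frac{\partial}{\partial y}\big)$ and let $\mathbf v$ be the vector field $\mathbf{v}_p=(-y,x)$ at $p=(x,y)\in\mathbb{D}^2$. Let $\epsilon\in\mathbb{R}$, $\rho=1/\sqrt{1+\epsilon^2}$ and $\mathbb{D}^2(\rho)=\{(x,y):x^2+y^2<\rho^2\}$. Let $F=\alpha+\beta$ be the Randers metric on $\mathbb{D}^2(\rho)$ defined, for nonzero tangent vectors $\mathbf y$, by $$\sqrt{h\Big(\frac{\mathbf y}{F(\mathbf y)}-\epsilon\mathbf v,\ \frac{\mathbf y}{F(\mathbf y)}-\epsilon\mathbf v\Big)}+h\Big(\mathbf u,\ \frac{\mathbf y}{F(\mathbf y)}-\epsilon\mathbf v\Big)=1,\qquad F(\mathbf y)>0,$$ (and $F(0)=0$), where $\alpha$ denotes its Riemannian part and $\beta$ its 1-form part. Then: (a) $F$ has constant curvature $\mathbf{K}=-1/4$; (b) the S-curvature of $F$ satisfies $\mathbf{S}=\frac32F$; (c) $F$ is not locally projectively flat unless $\epsilon=0$; (d) the Gauss curvature $\bar{\mathbf{K}}$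 of the Riemannian metric $\alpha$ is not constant unless $\epsilon=0$; when $\epsilon=0$, $\bar{\mathbf{K}}=-1$.
   Context: The function $\Phi(\mathbf y)=\sqrt{h(\mathbf y,\mathbf y)}+h(\mathbf u,\mathbf y)$ is the Funk metric on $\mathbb{D}^2$, characterized by $\frac{\mathbf y}{\Phi(\mathbf y)}+p\in\partial\mathbb{D}^2$ for $0\neq\mathbf y\in T_p\mathbb{D}^2$; the equation defining $F$ says $\Phi\big(\frac{\mathbf y}{F(\mathbf y)}-\epsilon\mathbf v_p\big)=1$. A Finsler metric on a manifold $M$ is a function $F:TM\to[0,\infty)$, smooth away from the zero section, positively homogeneous of degree one on each tangent space, such that in standard local coordinates $(x^i,y^i)$ of $TM$ the matrix $g_{ij}=\frac12[F^2]_{y^iy^j}$ is positive definite for $y\ne0$. A Randers metric is a Finsler metric $F=\alpha+\beta$, where $\alpha(\mathbf y)=\sqrt{a_{ij}(x)y^iy^j}$ is (the norm of) a Riemannian metric and $\beta(\mathbf y)=b_i(x)y^i$ is a 1-form with $\sup_{y\in T_xM\setminus\{0\}}\beta(y)/\alpha(y)<1$ at every $x$. The decomposition is unique: $\alpha(\mathbf y)=\frac12(F(\mathbf y)+F(-\mathbf y))$ and $\beta(\mathbf y)=\frac12(F(\mathbf y)-F(-\mathbf y))$. With $(g^{ij})=(g_{ij})^{-1}$, the geodesic coefficients of $F$ are $$G^i=\tfrac14 g^{ik}\Big\{2\frac{\partial g_{pk}}{\partial x^q}-\frac{\partial g_{pq}}{\partial x^k}\Big\}y^py^q,$$ and geodesics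 satisfy $\frac{d^2x^i}{dt^2}+2G^i(x,\frac{dx}{dt})=0$. The Riemann curvature is $\mathbf{R}_{\mathbf y}=R^i_{\ k}\,dx^k\otimes\frac{\partial}{\partial x^i}$ with $$R^i_{\ k}=2\frac{\partial G^i}{\partial x^k}-y^j\frac{\partial^2G^i}{\partial x^j\partial y^k}+2G^j\frac{\partial^2G^i}{\partial y^j\partial y^k}-\frac{\partial G^i}{\partial y^j}\frac{\partial G^j}{\partial y^k}.$$ $F$ has constant (flag) curvature $\mathbf{K}=\lambda$ if $R^i_{\ k}=\lambda\{F^2\delta^i_k-FF_{y^k}y^i\}$. The Busemann–Hausdorff volume form of $F$ on an $n$-manifold is $dV_F=\sigma(x)\,dx^1\cdots dx^n$, where $\sigma(x)=\mathrm{Vol}(B^n(1))/\mathrm{Vol}\{(y^i)\in\mathbb{R}^n:F(x,y)<1\}$, with $\mathrm{Vol}$ Euclidean volume and $B^n(1)$ the Euclidean unit ball. The S-curvature is $$\mathbf{S}(\mathbf y)=\frac{\partial G^i}{\partial y^i}(x,y)-\frac{y^i}{\sigma(x)}\frac{\partial\sigma}{\partial x^i}(x).$$ $F$ is locally projectively flat if around every point there is a local coordinate system in which the geodesics of $F$ are straight lines as point sets, equivalently in which $G^i=Py^i$ for some scalar function $P(x,y)$. *)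

theory Defs
  imports "HOL-Analysis.Analysis"
begin

section \<open>Smooth maps\<close>

text \<open>Meant for open sets \<open>S\<close> only.\<close>

primrec Ck_on :: "nat \<Rightarrow> ('a::euclidean_space \<Rightarrow> 'b::real_normed_vector) \<Rightarrow> 'a set \<Rightarrow> bool" where
  "Ck_on 0 f S \<longleftrightarrow> continuous_on S f"
| "Ck_on (Suc k) f S \<longleftrightarrow>
     f differentiable_on S \<and> (\<forall>b\<in>Basis. Ck_on k (\<lambda>x. frechet_derivative f (at x) b) S)"

definition smooth_on :: "'a set \<Rightarrow> ('a::euclidean_space \<Rightarrow> 'b::real_normed_vector) \<Rightarrow> bool" where
  "smooth_on S f \<longleftrightarrow> (\<forall>k. Ck_on k f S)"

section \<open>Finsler geometry on open subsets of real n-space\<close>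

text \<open>
  A Finsler metric on an open set \<open>U\<close> is a function \<open>F x y\<close> of a point \<open>x \<in> U\<close> and a tangent
  vector \<open>y\<close> at \<open>x\<close>, in the standard coordinates \<open>(x\<^sup>i, y\<^sup>i)\<close>. Its values for \<open>x\<close> outside \<open>U\<close> are
  irrelevant: every notion below evaluated at \<open>x \<in> U\<close> depends only on \<open>F\<close> near \<open>x\<close>.
\<close>

definition partial :: "'n::finite \<Rightarrow> (real^'n \<Rightarrow> real) \<Rightarrow> real^'n \<Rightarrow> real" where
  "partial i f x = frechet_derivative f (at x) (axis i 1)"

definition partial_x :: "'n::finite \<Rightarrow> (real^'n \<Rightarrow> real^'n \<Rightarrow> real) \<Rightarrow> real^'n \<Rightarrow> real^'n \<Rightarrow> real" where
  "partial_x i H x y = partial i (\<lambda>x'. H x' y) x"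

definition partial_y :: "'n::finite \<Rightarrow> (real^'n \<Rightarrow> real^'n \<Rightarrow> real) \<Rightarrow> real^'n \<Rightarrow> real^'n \<Rightarrow> real" where
  "partial_y i H x y = partial i (\<lambda>y'. H x y') y"

definition pos_def_matrix :: "real^'n^'n::finite \<Rightarrow> bool" where
  "pos_def_matrix A \<longleftrightarrow> transpose A = A \<and> (\<forall>z. z \<noteq> 0 \<longrightarrow> 0 < z \<bullet> (A *v z))"

definition fundamental_tensor ::
    "(real^'n::finite \<Rightarrow> real^'n \<Rightarrow> real) \<Rightarrow> real^'n \<Rightarrow> real^'n \<Rightarrow> real^'n^'n" where
  "fundamental_tensor F x y =
     (\<chi> i j. 1/2 * partial_y j (partial_y i (\<lambda>x y. (F x y)\<^sup>2)) x y)"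

definition finsler_metric_on ::
    "(real^'n::finite) set \<Rightarrow> (real^'n \<Rightarrow> real^'n \<Rightarrow> real) \<Rightarrow> bool" where
  "finsler_metric_on U F \<longleftrightarrow>
     (\<forall>x\<in>U. \<forall>y. 0 \<le> F x y) \<and>
     smooth_on (U \<times> (UNIV - {0})) (\<lambda>(x, y). F x y) \<and>
     (\<forall>x\<in>U. \<forall>y. \<forall>c>0. F x (c *\<^sub>R y) = c * F x y) \<and>
     (\<forall>x\<in>U. \<forall>y. y \<noteq> 0 \<longrightarrow> pos_def_matrix (fundamental_tensor F x y))"

text \<open>
  \<open>F = \<alpha> + \<beta>\<close> with \<open>\<alpha>(y) = sqrt (a\<^sub>i\<^sub>j y\<^sup>i y\<^sup>j)\<close> and \<open>\<beta>(y) = b\<^sub>i y\<^sup>i\<close>. On \<open>U\<close> the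
  metric \<open>F\<close> determines \<open>a\<close> and \<open>b\<close>.
\<close>

definition randers_metric_on ::
    "(real^'n::finite) set \<Rightarrow> (real^'n \<Rightarrow> real^'n \<Rightarrow> real)
      \<Rightarrow> (real^'n \<Rightarrow> real^'n^'n) \<Rightarrow> (real^'n \<Rightarrow> real^'n) \<Rightarrow> bool" where
  "randers_metric_on U F a b \<longleftrightarrow>
     finsler_metric_on U F \<and> smooth_on U a \<and> smooth_on U b \<and>
     (\<forall>x\<in>U. pos_def_matrix (a x)) \<and>
     (\<forall>x\<in>U. (SUP y\<in>UNIV - {0}. (b x \<bullet> y) / sqrt (y \<bullet> (a x *v y))) < 1) \<and>
     (\<forall>x\<in>U. \<forall>y. F x y = sqrt (y \<bullet> (a x *v y)) + b x \<bullet> y)"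

definition geodesic_coeff ::
    "(real^'n::finite \<Rightarrow> real^'n \<Rightarrow> real) \<Rightarrow> 'n \<Rightarrow> real^'n \<Rightarrow> real^'n \<Rightarrow> real" where
  "geodesic_coeff F i x y = 1/4 * (\<Sum>k\<in>UNIV. \<Sum>p\<in>UNIV. \<Sum>q\<in>UNIV.
     matrix_inv (fundamental_tensor F x y) $ i $ k *
     (2 * partial_x q (\<lambda>x y. fundamental_tensor F x y $ p $ k) x y
        - partial_x k (\<lambda>x y. fundamental_tensor F x y $ p $ q) x y) * y $ p * y $ q)"

definition riemann_curvature ::
    "(real^'n::finite \<Rightarrow> real^'n \<Rightarrow> real) \<Rightarrow> 'n \<Rightarrow> 'n \<Rightarrow> real^'n \<Rightarrow> real^'n \<Rightarrow> real" where
  "riemann_curvature F i k x y =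
     2 * partial_x k (geodesic_coeff F i) x y
     - (\<Sum>j\<in>UNIV. y $ j * partial_x j (partial_y k (geodesic_coeff F i)) x y)
     + 2 * (\<Sum>j\<in>UNIV. geodesic_coeff F j x y * partial_y j (partial_y k (geodesic_coeff F i)) x y)
     - (\<Sum>j\<in>UNIV. partial_y j (geodesic_coeff F i) x y * partial_y k (geodesic_coeff F j) x y)"

definition constant_curvature_on ::
    "(real^'n::finite) set \<Rightarrow> (real^'n \<Rightarrow> real^'n \<Rightarrow> real) \<Rightarrow> real \<Rightarrow> bool" where
  "constant_curvature_on U F c \<longleftrightarrow>
     (\<forall>x\<in>U. \<forall>y. y \<noteq> 0 \<longrightarrow> (\<forall>i k. riemann_curvature F i k x y =
        c * ((F x y)\<^sup>2 * (if i = k then 1 else 0) - F x y * partial_y k F x y * y $ i)))"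

definition BH_density :: "(real^'n::finite \<Rightarrow> real^'n \<Rightarrow> real) \<Rightarrow> real^'n \<Rightarrow> real" where
  "BH_density F x =
     measure lebesgue (ball (0::real^'n) 1) / measure lebesgue {y. F x y < 1}"

definition S_curvature :: "(real^'n::finite \<Rightarrow> real^'n \<Rightarrow> real) \<Rightarrow> real^'n \<Rightarrow> real^'n \<Rightarrow> real" where
  "S_curvature F x y =
     (\<Sum>i\<in>UNIV. partial_y i (geodesic_coeff F i) x y)
     - (\<Sum>i\<in>UNIV. y $ i / BH_density F x * partial i (BH_density F) x)"

text \<open>
  The expression of \<open>F\<close> in new coordinates \<open>\<xi>\<close>, where \<open>\<psi>\<close> is the inverse of the chart, that is
  \<open>x = \<psi>(\<xi>)\<close>.
\<close>

definition in_coordinates ::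
    "(real^'n::finite \<Rightarrow> real^'n) \<Rightarrow> (real^'n \<Rightarrow> real^'n \<Rightarrow> real) \<Rightarrow> real^'n \<Rightarrow> real^'n \<Rightarrow> real" where
  "in_coordinates \<psi> F \<xi> \<eta> = F (\<psi> \<xi>) (frechet_derivative \<psi> (at \<xi>) \<eta>)"

text \<open>
  \<open>\<phi>\<close> is a chart defined on the neighbourhood \<open>V\<close> of \<open>p\<close>, with inverse \<open>\<psi>\<close>; in this chart
  \<open>G\<^sup>i = P y\<^sup>i\<close>.
\<close>

definition locally_projectively_flat_on ::
    "(real^'n::finite) set \<Rightarrow> (real^'n \<Rightarrow> real^'n \<Rightarrow> real) \<Rightarrow> bool" where
  "locally_projectively_flat_on U F \<longleftrightarrow>
     (\<forall>p\<in>U. \<exists>V \<phi> \<psi>. open V \<and> p \<in> V \<and> V \<subseteq> U \<and> open (\<phi> ` V) \<and>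
        smooth_on V \<phi> \<and> smooth_on (\<phi> ` V) \<psi> \<and> (\<forall>x\<in>V. \<psi> (\<phi> x) = x) \<and>
        (\<exists>P. \<forall>\<xi>\<in>\<phi> ` V. \<forall>\<eta>. \<eta> \<noteq> 0 \<longrightarrow>
           (\<forall>i. geodesic_coeff (in_coordinates \<psi> F) i \<xi> \<eta> = P \<xi> \<eta> * \<eta> $ i)))"

section \<open>Gauss curvature of a Riemannian metric on an open subset of the plane\<close>

definition christoffel ::
    "(real^'n::finite \<Rightarrow> real^'n^'n) \<Rightarrow> 'n \<Rightarrow> 'n \<Rightarrow> 'n \<Rightarrow> real^'n \<Rightarrow> real" where
  "christoffel a i j k x = 1/2 * (\<Sum>l\<in>UNIV. matrix_inv (a x) $ i $ l *
     (partial j (\<lambda>x. a x $ l $ k) x + partial k (\<lambda>x. a x $ l $ j) x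
        - partial l (\<lambda>x. a x $ j $ k) x))"

text \<open>
  The component \<open>R\<^sup>l\<^sub>k\<^sub>i\<^sub>j\<close> of the Riemann tensor, with the convention
  \<open>R(\<partial>\<^sub>i, \<partial>\<^sub>j) \<partial>\<^sub>k = R\<^sup>l\<^sub>k\<^sub>i\<^sub>j \<partial>\<^sub>l\<close> and
  \<open>R(X, Y) = \<nabla>\<^sub>X \<nabla>\<^sub>Y - \<nabla>\<^sub>Y \<nabla>\<^sub>X - \<nabla>\<^bsub>[X,Y]\<^esub>\<close>. With it the Gauss curvature is
  \<open>\<langle>R(\<partial>\<^sub>1, \<partial>\<^sub>2) \<partial>\<^sub>2, \<partial>\<^sub>1\<rangle> / det a\<close>.
\<close>

definition riemann_tensor ::
    "(real^'n::finite \<Rightarrow> real^'n^'n) \<Rightarrow> 'n \<Rightarrow> 'n \<Rightarrow> 'n \<Rightarrow> 'n \<Rightarrow> real^'n \<Rightarrow> real" where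
  "riemann_tensor a l k i j x =
     partial i (christoffel a l j k) x - partial j (christoffel a l i k) x
     + (\<Sum>m\<in>UNIV. christoffel a l i m x * christoffel a m j k x
                 - christoffel a l j m x * christoffel a m i k x)"

definition gauss_curvature :: "(real^2 \<Rightarrow> real^2^2) \<Rightarrow> real^2 \<Rightarrow> real" where
  "gauss_curvature a x =
     (\<Sum>l\<in>UNIV. a x $ 1 $ l * riemann_tensor a l 2 1 2 x) / det (a x)"

section \<open>The Klein and Funk metrics of the unit disk\<close>

definition disk :: "real \<Rightarrow> (real^2) set" where
  "disk r = {p. (p$1)\<^sup>2 + (p$2)\<^sup>2 < r\<^sup>2}"

text \<open>The symmetric bilinear form obtained by polarization from the quadratic form \<open>h(y, y)\<close>.\<close>

definition klein_metric :: "real^2 \<Rightarrow> real^2 \<Rightarrow> real^2 \<Rightarrow> real" where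
  "klein_metric p y z =
     ((y$1 * z$1 + y$2 * z$2) - (p$1 * y$2 - p$2 * y$1) * (p$1 * z$2 - p$2 * z$1))
       / (1 - (p$1)\<^sup>2 - (p$2)\<^sup>2)\<^sup>2"

definition u_field :: "real^2 \<Rightarrow> real^2" where
  "u_field p = (1 - (p$1)\<^sup>2 - (p$2)\<^sup>2) *\<^sub>R p"

definition v_field :: "real^2 \<Rightarrow> real^2" where
  "v_field p = vector [- (p$2), p$1]"

definition funk_metric :: "real^2 \<Rightarrow> real^2 \<Rightarrow> real" where
  "funk_metric p y = sqrt (klein_metric p y y) + klein_metric p (u_field p) y"

text \<open>
  The metric \<open>F\<close> is given by an implicit equation; the lemmas below show that it has exactly
  one positive solution.
\<close>

lemma funk_metric_eq_1_iff:
  assumes "p \<in> disk 1"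
  shows "funk_metric p w = 1 \<longleftrightarrow> (p$1 + w$1)\<^sup>2 + (p$2 + w$2)\<^sup>2 = 1"
proof -
  define d where "d = 1 - (p$1)\<^sup>2 - (p$2)\<^sup>2"
  define N where "N = (w$1)\<^sup>2 + (w$2)\<^sup>2"
  define c where "c = p$1 * w$1 + p$2 * w$2"
  have d: "d > 0" using assms by (simp add: d_def disk_def)
  have N: "N \<ge> 0" by (simp add: N_def)
  have "klein_metric p w w = (d * N + c\<^sup>2) / d\<^sup>2"
    unfolding klein_metric_def d_def[symmetric]
    by (rule arg_cong[where f = "\<lambda>t. t / d\<^sup>2"])
       (simp add: d_def N_def c_def power2_eq_square algebra_simps)
  hence s: "sqrt (klein_metric p w w) = sqrt (d * N + c\<^sup>2) / d"
    using d by (simp add: real_sqrt_divide)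
  have "klein_metric p (u_field p) w = d * c / d\<^sup>2"
    unfolding klein_metric_def u_field_def d_def[symmetric]
    by (rule arg_cong[where f = "\<lambda>t. t / d\<^sup>2"]) (simp add: c_def algebra_simps)
  hence "funk_metric p w = (sqrt (d * N + c\<^sup>2) + c) / d"
    using d s by (simp add: funk_metric_def power2_eq_square add_divide_distrib)
  hence "funk_metric p w = 1 \<longleftrightarrow> sqrt (d * N + c\<^sup>2) = d - c"
    using d by (auto simp: field_simps)
  also have "\<dots> \<longleftrightarrow> d \<ge> c \<and> d * N + c\<^sup>2 = (d - c)\<^sup>2"
    using d N by (smt (verit) real_sqrt_ge_zero real_sqrt_pow2 real_sqrt_unique
        mult_nonneg_nonneg zero_le_power2)
  also have "d * N + c\<^sup>2 = (d - c)\<^sup>2 \<longleftrightarrow> d * N = d * (d - 2 * c)"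
    by (simp add: power2_eq_square algebra_simps)
  also have "\<dots> \<longleftrightarrow> N = d - 2 * c" using d by simp
  also have "d \<ge> c \<and> N = d - 2 * c \<longleftrightarrow> N = d - 2 * c" using N d by auto
  also have "\<dots> \<longleftrightarrow> (p$1 + w$1)\<^sup>2 + (p$2 + w$2)\<^sup>2 = 1"
    by (auto simp: N_def d_def c_def power2_eq_square algebra_simps)
  finally show ?thesis .
qed

lemma positive_root_unique:
  fixes A B C :: real
  assumes A: "A > 0" and C: "C < 0"
  shows "\<exists>!s. s > 0 \<and> A * s\<^sup>2 + 2 * B * s + C = 0"
proof -
  define D where "D = sqrt (B\<^sup>2 - A * C)"
  have AC: "A * C < 0" using A C by (simp add: mult_pos_neg)
  hence D2: "D\<^sup>2 = B\<^sup>2 - A * C"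
    unfolding D_def by (intro real_sqrt_pow2) (smt (verit) zero_le_power2)
  have D: "D > \<bar>B\<bar>"
    unfolding D_def using AC by (intro real_less_rsqrt) simp
  have eq: "A * (A * s\<^sup>2 + 2 * B * s + C) = (A * s + B - D) * (A * s + B + D)" for s
  proof -
    have "(A * s + B - D) * (A * s + B + D) = (A * s + B)\<^sup>2 - D\<^sup>2"
      by (simp add: power2_eq_square algebra_simps)
    thus ?thesis unfolding D2 by (simp add: power2_eq_square algebra_simps)
  qed
  have iff: "s > 0 \<and> A * s\<^sup>2 + 2 * B * s + C = 0 \<longleftrightarrow> s = (D - B) / A" for s
  proof
    assume s: "s > 0 \<and> A * s\<^sup>2 + 2 * B * s + C = 0"
    have "A * s > 0" using s A by simp
    hence "A * s + B + D > 0" using D by linarith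
    moreover have "(A * s + B - D) * (A * s + B + D) = 0" using eq[of s] s by simp
    ultimately have "A * s + B - D = 0" by simp
    thus "s = (D - B) / A" using A by (simp add: field_simps)
  next
    assume s: "s = (D - B) / A"
    hence "A * s + B - D = 0" using A by simp
    hence "A * s\<^sup>2 + 2 * B * s + C = 0" using eq[of s] A by simp
    moreover have "s > 0" using s D A by simp
    ultimately show "s > 0 \<and> A * s\<^sup>2 + 2 * B * s + C = 0" by simp
  qed
  show ?thesis unfolding iff by simp
qed

lemma F_exists_unique:
  fixes \<epsilon> :: real
  assumes p: "p \<in> disk (1 / sqrt (1 + \<epsilon>\<^sup>2))" and y: "y \<noteq> 0"
  shows "\<exists>!t. t > 0 \<and> funk_metric p ((1 / t) *\<^sub>R y - \<epsilon> *\<^sub>R v_field p) = 1"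
proof -
  define N where "N = (p$1)\<^sup>2 + (p$2)\<^sup>2"
  have e: "1 + \<epsilon>\<^sup>2 > 0" by (smt (verit) zero_le_power2)
  have "N < 1 / (1 + \<epsilon>\<^sup>2)" using p e by (simp add: disk_def N_def power_divide)
  hence Ne: "N * (1 + \<epsilon>\<^sup>2) < 1" using e by (simp add: field_simps)
  have "N * 1 \<le> N * (1 + \<epsilon>\<^sup>2)" by (rule mult_left_mono) (auto simp: N_def)
  hence p1: "p \<in> disk 1" using Ne by (simp add: disk_def N_def)
  define A where "A = (y$1)\<^sup>2 + (y$2)\<^sup>2"
  define B where "B = (p$1 + \<epsilon> * p$2) * y$1 + (p$2 - \<epsilon> * p$1) * y$2"
  have "y$1 \<noteq> 0 \<or> y$2 \<noteq> 0" using y by (auto simp: vec_eq_iff forall_2)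
  hence A: "A > 0" by (simp add: A_def sum_power2_gt_zero_iff)
  have "funk_metric p ((1 / t) *\<^sub>R y - \<epsilon> *\<^sub>R v_field p) = 1 \<longleftrightarrow>
      A * (1/t)\<^sup>2 + 2 * B * (1/t) + (N * (1 + \<epsilon>\<^sup>2) - 1) = 0" for t
  proof -
    have "(p$1 + (s * y$1 + \<epsilon> * p$2))\<^sup>2 + (p$2 + (s * y$2 - \<epsilon> * p$1))\<^sup>2 =
        A * s\<^sup>2 + 2 * B * s + N * (1 + \<epsilon>\<^sup>2)" for s
      by (simp add: A_def B_def N_def power2_eq_square algebra_simps)
    from this[of "1/t"] show ?thesis
      unfolding funk_metric_eq_1_iff[OF p1] by (auto simp: v_field_def)
  qed
  note eqv = this
  have "N * (1 + \<epsilon>\<^sup>2) - 1 < 0" using Ne by simp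
  from positive_root_unique[OF A this, of B]
  obtain s where s: "s > 0" "A * s\<^sup>2 + 2 * B * s + (N * (1 + \<epsilon>\<^sup>2) - 1) = 0"
    and uniq: "\<And>r. r > 0 \<Longrightarrow> A * r\<^sup>2 + 2 * B * r + (N * (1 + \<epsilon>\<^sup>2) - 1) = 0 \<Longrightarrow> r = s"
    by blast
  show ?thesis
  proof (rule ex1I[of _ "1 / s"])
    show "1 / s > 0 \<and> funk_metric p ((1 / (1 / s)) *\<^sub>R y - \<epsilon> *\<^sub>R v_field p) = 1"
      unfolding eqv using s by simp
  next
    fix t assume t: "t > 0 \<and> funk_metric p ((1 / t) *\<^sub>R y - \<epsilon> *\<^sub>R v_field p) = 1"
    hence "1 / t = s" unfolding eqv by (intro uniq) simp_all
    thus "t = 1 / s" using t s(1) by (auto simp: field_simps)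
  qed
qed

end

(*
  Write J for the rotation by a right angle and q = p - eps J p. By the characterization of the Funk
  metric, F = F(p, y) is determined by |q + y / F| = 1, so F is the Funk metric of the unit disk at the
  point q, evaluated on y, and every indicatrix is a unit circle; in particular the
  Busemann-Hausdorff density is 1. With the unit vector n = q + y / F, the vector m = y / F and
  k = <n, m> one finds F_y = f = n / k, F_x = F (1 + eps J) f and the fundamental tensor
  f f^T + (J m) (J m)^T / k^3, and the spray is quadratic in y with coefficients polynomial in F:
      G = F y / 2 - eps F J y - eps F^2 J q / 2.
  Curvature and S-curvature follow by differentiating this formula. At the origin G is
  odd in y with J y component - eps |y| J y, and a change of coordinates only adds terms even in y.
  The Riemannian part has curvature eps^2 - 1 - 6 eps^2 / (1 - |q|^2).
*)

theory Submission
  imports Defs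
begin

section \<open>Smooth maps\<close>

text \<open>The quantities \<open>F\<close>, \<open>m\<close>, \<open>n\<close>,
  \<open>\<kappa>\<close>, \<open>f\<close> form a system closed under differentiation: the gradient
  of each is a rational expression in them, the unit vectors and J. The relations among them rest on
  |n| = 1 and <f, m> = 1, so each curvature identity becomes algebra in this frame. The spray
  formula is verified, not derived. By definition the spray involves third derivatives of F^2 and
  the inverse of the fundamental tensor g. The x-derivatives of g occur only contracted with y, once
  or twice, and these contractions are the x-gradients of F f_k and F^2, since g y = F f and <y, g
  y> = F^2. The inverse is bypassed by checking that g G equals the lowered spray. The origin is
  chosen for the flatness argument because q = 0 there: F is the Euclidean norm and g is the
  identity for every y, so the y-derivatives of g vanish and the unknown second derivatives of a
  chart enter only through a quadratic form in the new tangent coordinates. The Gauss curvature is a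
  direct computation in components, with D = 1 - |q|^2 kept as an atom until denominators are
  cleared.\<close>

lemma Ck_on_cong:
  assumes "open S" "\<And>x. x \<in> S \<Longrightarrow> f x = g x"
  shows "Ck_on k f S \<longleftrightarrow> Ck_on k g S"
  using assms(2)
proof (induction k arbitrary: f g)
  case 0
  then show ?case by (simp cong: continuous_on_cong)
next
  case (Suc k)
  have fr: "frechet_derivative f (at x) = frechet_derivative g (at x)" if x: "x \<in> S" for x
  proof -
    have "(f has_derivative D) (at x) \<longleftrightarrow> (g has_derivative D) (at x)" for D
      using has_derivative_transform_within_open[OF _ assms(1) x, of f D UNIV g]
        has_derivative_transform_within_open[OF _ assms(1) x, of g D UNIV f] Suc.prems
      by auto
    thus ?thesis by (simp add: frechet_derivative_def)
  qed
  have "f differentiable_on S \<longleftrightarrow> g differentiable_on S"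
    unfolding differentiable_on_def differentiable_def
    using Suc.prems has_derivative_transform by (metis (no_types, lifting))
  moreover have "Ck_on k (\<lambda>x. frechet_derivative f (at x) b) S \<longleftrightarrow>
      Ck_on k (\<lambda>x. frechet_derivative g (at x) b) S" for b
    by (rule Suc.IH) (simp add: fr)
  ultimately show ?case by simp
qed

text \<open>Lets an explicit derivative stand in for \<open>frechet_derivative\<close>, which is a
  choice; the closure rules below enter their inductions through it.\<close>

lemma Ck_on_SucI:
  assumes "open S" "\<And>x. x \<in> S \<Longrightarrow> (f has_derivative f' x) (at x)"
    "\<And>b. b \<in> Basis \<Longrightarrow> Ck_on k (\<lambda>x. f' x b) S"
  shows "Ck_on (Suc k) f S"
proof -
  have "f differentiable_on S"
    using assms(2) by (auto simp: differentiable_on_def differentiable_def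
        intro: has_derivative_at_withinI)
  moreover have "Ck_on k (\<lambda>x. frechet_derivative f (at x) b) S" if "b \<in> Basis" for b
    using assms(3)[OF that] Ck_on_cong[OF assms(1), of "\<lambda>x. f' x b" "\<lambda>x. frechet_derivative f (at x) b" k]
      frechet_derivative_at[OF assms(2)] by metis
  ultimately show ?thesis by simp
qed

text \<open>The derivative of a product, an inverse or a root contains the undifferentiated function
  again, so the inductions need its regularity one order lower.\<close>

lemma Ck_on_SucD: "Ck_on (Suc k) f S \<Longrightarrow> Ck_on k f S"
proof (induction k arbitrary: f)
  case 0
  then show ?case by (simp add: differentiable_imp_continuous_on)
next
  case (Suc k)
  then show ?case by (metis Ck_on.simps(2))
qed

lemma Ck_on_has_derivative:
  assumes "open S" "Ck_on (Suc k) f S" "x \<in> S"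
  shows "(f has_derivative frechet_derivative f (at x)) (at x)"
  using assms by (metis Ck_on.simps(2) at_within_open differentiable_on_def frechet_derivative_works)

lemma Ck_on_const: "open S \<Longrightarrow> Ck_on k (\<lambda>x. c) S"
proof (induction k arbitrary: c)
  case (Suc k)
  show ?case by (rule Ck_on_SucI[where f' = "\<lambda>x h. 0"]) (auto intro: Suc)
qed simp

lemma Ck_on_ident: "open S \<Longrightarrow> Ck_on k (\<lambda>x. x) S"
proof (cases k)
  case (Suc k')
  show "open S \<Longrightarrow> ?thesis"
    unfolding Suc by (rule Ck_on_SucI[where f' = "\<lambda>x h. h"]) (auto intro: Ck_on_const)
qed simp

lemma Ck_on_bounded_linear:
  assumes "open S" "bounded_linear L"
  shows "Ck_on k f S \<Longrightarrow> Ck_on k (\<lambda>x. L (f x)) S"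
proof (induction k arbitrary: f)
  case 0
  then show ?case using assms by (auto intro: bounded_linear.continuous_on)
next
  case (Suc k)
  show ?case
  proof (rule Ck_on_SucI[where f' = "\<lambda>x h. L (frechet_derivative f (at x) h)"])
    show "((\<lambda>x. L (f x)) has_derivative (\<lambda>h. L (frechet_derivative f (at x) h))) (at x)"
      if "x \<in> S" for x
      using bounded_linear.has_derivative[OF assms(2) Ck_on_has_derivative[OF assms(1) Suc.prems that]] .
  qed (use Suc assms in auto)
qed

lemma Ck_on_add:
  assumes "open S"
  shows "Ck_on k f S \<Longrightarrow> Ck_on k g S \<Longrightarrow> Ck_on k (\<lambda>x. f x + g x) S"
proof (induction k arbitrary: f g)
  case 0
  then show ?case by (auto intro: continuous_intros)
next
  case (Suc k)
  show ?case
  proof (rule Ck_on_SucI[OF assms])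
    show "((\<lambda>x. f x + g x) has_derivative
        (\<lambda>h. frechet_derivative f (at x) h + frechet_derivative g (at x) h)) (at x)"
      if "x \<in> S" for x
      using has_derivative_add[OF Suc.prems[THEN Ck_on_has_derivative[OF assms _ that]]] .
  qed (use Suc in auto)
qed

lemma Ck_on_scaleR:
  fixes f :: "'a::euclidean_space \<Rightarrow> real"
  assumes "open S"
  shows "Ck_on k f S \<Longrightarrow> Ck_on k g S \<Longrightarrow> Ck_on k (\<lambda>x. f x *\<^sub>R g x) S"
proof (induction k arbitrary: f g)
  case 0
  then show ?case by (auto intro: continuous_intros)
next
  case (Suc k)
  show ?case
  proof (rule Ck_on_SucI[OF assms])
    show "((\<lambda>x. f x *\<^sub>R g x) has_derivative
        (\<lambda>h. f x *\<^sub>R frechet_derivative g (at x) h + frechet_derivative f (at x) h *\<^sub>R g x)) (at x)"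
      if "x \<in> S" for x
      using has_derivative_scaleR[OF Suc.prems[THEN Ck_on_has_derivative[OF assms _ that]]] .
  qed (use Suc Suc.prems[THEN Ck_on_SucD] in \<open>auto intro!: Ck_on_add assms\<close>)
qed

text \<open>The derivative is a product of two copies of \<open>inverse f\<close> with the
  derivative of \<open>f\<close>, so the induction closes within products. The square root works the
  same way, using this lemma for the factor 1 / sqrt f.\<close>

lemma Ck_on_inverse:
  fixes f :: "'a::euclidean_space \<Rightarrow> real"
  assumes "open S" "\<And>x. x \<in> S \<Longrightarrow> f x \<noteq> 0"
  shows "Ck_on k f S \<Longrightarrow> Ck_on k (\<lambda>x. inverse (f x)) S"
proof (induction k)
  case 0
  then show ?case using assms by (auto intro: continuous_intros)
next
  case (Suc k)
  note IH = Suc.IH[OF Ck_on_SucD[OF Suc.prems]]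
  show ?case
  proof (rule Ck_on_SucI[OF assms(1)])
    show "((\<lambda>x. inverse (f x)) has_derivative
        (\<lambda>h. - (inverse (f x) *\<^sub>R frechet_derivative f (at x) h *\<^sub>R inverse (f x)))) (at x)"
      if "x \<in> S" for x
      using has_derivative_inverse'[OF assms(2)[OF that]]
      by (auto intro!: derivative_eq_intros Ck_on_has_derivative[OF assms(1) Suc.prems that] simp: assms(2) that)
    show "Ck_on k (\<lambda>x. - (inverse (f x) *\<^sub>R frechet_derivative f (at x) b *\<^sub>R inverse (f x))) S"
      if "b \<in> Basis" for b
      using IH Suc.prems that
      by (intro Ck_on_bounded_linear[OF assms(1) bounded_linear_minus[OF bounded_linear_ident]]
          Ck_on_scaleR assms(1)) auto
  qed
qed

lemma Ck_on_sqrt: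
  fixes f :: "'a::euclidean_space \<Rightarrow> real"
  assumes "open S" "\<And>x. x \<in> S \<Longrightarrow> f x > 0"
  shows "Ck_on k f S \<Longrightarrow> Ck_on k (\<lambda>x. sqrt (f x)) S"
proof (induction k)
  case 0
  then show ?case using assms by (auto intro: continuous_intros)
next
  case (Suc k)
  note IH = Suc.IH[OF Ck_on_SucD[OF Suc.prems]]
  show ?case
  proof (rule Ck_on_SucI[OF assms(1)])
    show "((\<lambda>x. sqrt (f x)) has_derivative
        (\<lambda>h. frechet_derivative f (at x) h *\<^sub>R inverse (sqrt (f x)) /\<^sub>R 2)) (at x)"
      if "x \<in> S" for x
      using assms(2)[OF that]
      by (auto intro!: derivative_eq_intros Ck_on_has_derivative[OF assms(1) Suc.prems that] simp: field_simps)
    show "Ck_on k (\<lambda>x. frechet_derivative f (at x) b *\<^sub>R inverse (sqrt (f x)) /\<^sub>R 2) S"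
      if "b \<in> Basis" for b
      using IH Suc.prems that assms
      by (intro Ck_on_bounded_linear[OF assms(1) bounded_linear_scaleR_right]
          Ck_on_scaleR assms(1) Ck_on_inverse) (auto simp: less_imp_neq[symmetric] dest: assms(2))
  qed
qed

lemma Ck_on_Basis:
  fixes f :: "'a::euclidean_space \<Rightarrow> 'b::euclidean_space"
  assumes "open S" "\<And>b. b \<in> Basis \<Longrightarrow> Ck_on k (\<lambda>x. f x \<bullet> b) S"
  shows "Ck_on k f S"
proof -
  have "Ck_on k (\<lambda>x. \<Sum>b\<in>B. (f x \<bullet> b) *\<^sub>R b) S" if "B \<subseteq> Basis" for B
    using finite_subset[OF that finite_Basis] that
  proof (induction B rule: finite_induct)
    case (insert b B)
    then show ?case
      by (auto intro!: Ck_on_add Ck_on_scaleR Ck_on_const assms)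
  qed (simp add: Ck_on_const assms(1))
  from this[OF order_refl] show ?thesis by (simp add: euclidean_representation)
qed

lemma smooth_on_const: "open S \<Longrightarrow> smooth_on S (\<lambda>x. c)"
  by (simp add: smooth_on_def Ck_on_const)

lemma smooth_on_bounded_linear:
  "open S \<Longrightarrow> bounded_linear L \<Longrightarrow> smooth_on S L"
  using Ck_on_bounded_linear[OF _ _ Ck_on_ident] by (auto simp: smooth_on_def)

lemma smooth_on_compose_linear:
  "open S \<Longrightarrow> bounded_linear L \<Longrightarrow> smooth_on S f \<Longrightarrow> smooth_on S (\<lambda>x. L (f x))"
  by (auto simp: smooth_on_def intro: Ck_on_bounded_linear)

lemma smooth_on_add: "open S \<Longrightarrow> smooth_on S f \<Longrightarrow> smooth_on S g \<Longrightarrow> smooth_on S (\<lambda>x. f x + g x)"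
  by (simp add: smooth_on_def Ck_on_add)

lemma smooth_on_mult:
  fixes f g :: "'a::euclidean_space \<Rightarrow> real"
  shows "open S \<Longrightarrow> smooth_on S f \<Longrightarrow> smooth_on S g \<Longrightarrow> smooth_on S (\<lambda>x. f x * g x)"
  using Ck_on_scaleR[of S _ f g] by (simp add: smooth_on_def)

lemma smooth_on_diff:
  assumes "open S" "smooth_on S f" "smooth_on S g"
  shows "smooth_on S (\<lambda>x. f x - g x)"
  using smooth_on_add[OF assms(1,2) smooth_on_compose_linear[OF assms(1)
        bounded_linear_minus[OF bounded_linear_ident] assms(3)]] by simp

lemma smooth_on_divide:
  fixes f g :: "'a::euclidean_space \<Rightarrow> real"
  assumes "open S" "smooth_on S f" "smooth_on S g" "\<And>x. x \<in> S \<Longrightarrow> g x \<noteq> 0"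
  shows "smooth_on S (\<lambda>x. f x / g x)"
  using smooth_on_mult[OF assms(1,2), of "\<lambda>x. inverse (g x)"] Ck_on_inverse[OF assms(1,4)] assms(3)
  by (simp add: smooth_on_def divide_inverse)

lemma smooth_on_sqrt:
  fixes f :: "'a::euclidean_space \<Rightarrow> real"
  shows "open S \<Longrightarrow> (\<And>x. x \<in> S \<Longrightarrow> f x > 0) \<Longrightarrow> smooth_on S f \<Longrightarrow> smooth_on S (\<lambda>x. sqrt (f x))"
  by (simp add: smooth_on_def Ck_on_sqrt)

lemma smooth_on_Basis:
  fixes f :: "'a::euclidean_space \<Rightarrow> 'b::euclidean_space"
  shows "open S \<Longrightarrow> (\<And>b. b \<in> Basis \<Longrightarrow> smooth_on S (\<lambda>x. f x \<bullet> b)) \<Longrightarrow> smooth_on S f"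
  by (simp add: smooth_on_def Ck_on_Basis)

lemma smooth_on_cong:
  "open S \<Longrightarrow> (\<And>x. x \<in> S \<Longrightarrow> f x = g x) \<Longrightarrow> smooth_on S f \<longleftrightarrow> smooth_on S g"
  unfolding smooth_on_def using Ck_on_cong by blast

section \<open>Gradients in the base point and in the tangent vector\<close>

text \<open>Joint differentiability in base point and tangent vector, stored as a pair of gradients.
  Formulas are differentiated in both variables, and a change of coordinates later moves both at
  once.\<close>

definition has_grads ::
    "(real^'n::finite \<Rightarrow> real^'n \<Rightarrow> real) \<Rightarrow> real^'n \<Rightarrow> real^'n \<Rightarrow> real^'n \<Rightarrow> real^'n \<Rightarrow> bool" where
  "has_grads H u v x y \<longleftrightarrow>
     ((\<lambda>z. H (fst z) (snd z)) has_derivative (\<lambda>h. u \<bullet> fst h + v \<bullet> snd h)) (at (x, y))"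

lemma has_grads_eqI: "has_grads H u v x y \<Longrightarrow> u = u' \<Longrightarrow> v = v' \<Longrightarrow> has_grads H u' v' x y"
  by simp

lemma has_grads_cong:
  assumes "open W" "(x, y) \<in> W" "\<And>x y. (x, y) \<in> W \<Longrightarrow> H x y = H' x y" "has_grads H u v x y"
  shows "has_grads H' u v x y"
  using has_derivative_transform_within_open[OF assms(4)[unfolded has_grads_def] assms(1,2)] assms(3)
  by (auto simp: has_grads_def)

lemma has_grads_const: "has_grads (\<lambda>x y. c) 0 0 x y"
  by (simp add: has_grads_def)

lemma has_grads_fst: "has_grads (\<lambda>x y. x $ i) (axis i 1) 0 x y"
  unfolding has_grads_def
  by (auto intro!: derivative_eq_intros bounded_linear.has_derivative[OF bounded_linear_vec_nth]
      simp: inner_axis' )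

lemma has_grads_snd: "has_grads (\<lambda>x y. y $ i) 0 (axis i 1) x y"
  unfolding has_grads_def
  by (auto intro!: derivative_eq_intros bounded_linear.has_derivative[OF bounded_linear_vec_nth]
      simp: inner_axis' )

lemma has_grads_add:
  "has_grads H u v x y \<Longrightarrow> has_grads H' u' v' x y \<Longrightarrow> has_grads (\<lambda>x y. H x y + H' x y) (u + u') (v + v') x y"
  unfolding has_grads_def
  by (drule (1) has_derivative_add) (simp add: inner_add_left algebra_simps)

lemma has_grads_diff:
  "has_grads H u v x y \<Longrightarrow> has_grads H' u' v' x y \<Longrightarrow> has_grads (\<lambda>x y. H x y - H' x y) (u - u') (v - v') x y"
  unfolding has_grads_def
  by (drule (1) has_derivative_diff) (simp add: inner_diff_left algebra_simps)

lemma has_grads_minus: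
  "has_grads H u v x y \<Longrightarrow> has_grads (\<lambda>x y. - H x y) (- u) (- v) x y"
  unfolding has_grads_def
  by (drule has_derivative_minus) (simp add: algebra_simps)

lemma has_grads_mult:
  "has_grads H u v x y \<Longrightarrow> has_grads H' u' v' x y \<Longrightarrow>
     has_grads (\<lambda>x y. H x y * H' x y) (H x y *\<^sub>R u' + H' x y *\<^sub>R u) (H x y *\<^sub>R v' + H' x y *\<^sub>R v) x y"
  unfolding has_grads_def
  by (drule (1) has_derivative_mult) (simp add: inner_add_left algebra_simps)

lemma has_grads_divide:
  "has_grads H u v x y \<Longrightarrow> has_grads H' u' v' x y \<Longrightarrow> H' x y \<noteq> 0 \<Longrightarrow>
     has_grads (\<lambda>x y. H x y / H' x y) ((1 / H' x y) *\<^sub>R u - (H x y / (H' x y)\<^sup>2) *\<^sub>R u')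
       ((1 / H' x y) *\<^sub>R v - (H x y / (H' x y)\<^sup>2) *\<^sub>R v') x y"
  unfolding has_grads_def
  by (drule (1) has_derivative_divide', simp, erule has_derivative_eq_rhs)
    (simp add: fun_eq_iff inner_diff_left inner_add_left divide_simps power2_eq_square, simp add: algebra_simps)

lemma has_grads_sqrt:
  "has_grads H u v x y \<Longrightarrow> H x y > 0 \<Longrightarrow>
     has_grads (\<lambda>x y. sqrt (H x y)) ((1 / (2 * sqrt (H x y))) *\<^sub>R u) ((1 / (2 * sqrt (H x y))) *\<^sub>R v) x y"
  unfolding has_grads_def
  by (drule has_derivative_real_sqrt[rotated]) (simp_all add: field_simps)

lemmas has_grads_intros = has_grads_const has_grads_fst has_grads_snd has_grads_add has_grads_diff
  has_grads_minus has_grads_mult has_grads_divide has_grads_sqrt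

text \<open>Uniqueness of the derivative turns the choice inside \<open>partial\<close> into the
  computed value.\<close>

lemma partialI: "(f has_derivative f') (at x) \<Longrightarrow> f' (axis i 1) = c \<Longrightarrow> partial i f x = c"
  using frechet_derivative_at by (fastforce simp: partial_def)

lemma has_grads_fst_derivative:
  assumes "has_grads H u v x y"
  shows "((\<lambda>x. H x y) has_derivative (\<lambda>h. u \<bullet> h)) (at x)"
proof -
  have "((\<lambda>x. (x, y)) has_derivative (\<lambda>h. (h, 0))) (at x)"
    by (auto intro!: derivative_eq_intros)
  from has_derivative_compose[OF this, of "\<lambda>z. H (fst z) (snd z)" "\<lambda>h. u \<bullet> fst h + v \<bullet> snd h"] assms
  show ?thesis by (simp add: has_grads_def)
qed

lemma has_grads_snd_derivative:
  assumes "has_grads H u v x y"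
  shows "((\<lambda>y. H x y) has_derivative (\<lambda>h. v \<bullet> h)) (at y)"
proof -
  have "((\<lambda>y. (x, y)) has_derivative (\<lambda>h. (0, h))) (at y)"
    by (auto intro!: derivative_eq_intros)
  from has_derivative_compose[OF this, of "\<lambda>z. H (fst z) (snd z)" "\<lambda>h. u \<bullet> fst h + v \<bullet> snd h"] assms
  show ?thesis by (simp add: has_grads_def)
qed

lemma partial_x_eq: "has_grads H u v x y \<Longrightarrow> partial_x i H x y = u $ i"
  unfolding partial_x_def
  by (rule partialI[OF has_grads_fst_derivative]) (auto simp: inner_axis)

lemma partial_y_eq: "has_grads H u v x y \<Longrightarrow> partial_y i H x y = v $ i"
  unfolding partial_y_def
  by (rule partialI[OF has_grads_snd_derivative]) (auto simp: inner_axis)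

section \<open>Matrix inverses and uniqueness of gradients\<close>

lemma matrix_inv_mult_cancel:
  fixes A :: "real^'n::finite^'n"
  assumes "invertible A"
  shows "matrix_inv A *v (A *v z) = z"
proof -
  have "matrix_inv A ** A = mat 1"
    using someI_ex[OF assms[unfolded invertible_def]] by (simp add: matrix_inv_def)
  thus ?thesis by (simp add: matrix_vector_mul_assoc)
qed

lemma pos_def_matrix_invertible:
  fixes A :: "real^'n::finite^'n"
  assumes "pos_def_matrix A"
  shows "invertible A"
proof -
  have "z = 0" if "A *v z = 0" for z
    using assms that by (force simp: pos_def_matrix_def)
  thus ?thesis by (simp add: invertible_left_inverse matrix_left_invertible_ker)
qed

lemma partial_eq: "has_grads (\<lambda>x y. h x) u v x y \<Longrightarrow> partial i h x = u $ i"
  using partial_x_eq[of "\<lambda>x y. h x"] by (simp add: partial_x_def)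

lemma matrix_inv_eqI:
  fixes A B :: "real^'n::finite^'n"
  assumes "A ** B = mat 1"
  shows "matrix_inv A = B"
proof -
  have BA: "B ** A = mat 1" using assms by (simp add: matrix_left_right_inverse)
  have "matrix_inv A ** A = mat 1"
    using someI[of "\<lambda>A'. A ** A' = mat 1 \<and> A' ** A = mat 1", OF conjI[OF assms BA]]
    by (simp add: matrix_inv_def)
  thus ?thesis using assms by (metis matrix_mul_assoc matrix_mul_lid matrix_mul_rid)
qed

lemma linear_eq_sum_axis:
  assumes "linear (L :: real^'n::finite \<Rightarrow> real^'m)"
  shows "L y = (\<Sum>i\<in>UNIV. y $ i *\<^sub>R L (axis i 1))"
proof -
  have "L y = L (\<Sum>i\<in>UNIV. y $ i *\<^sub>R axis i 1)" by (simp add: basis_expansion scalar_mult_eq_scaleR[symmetric])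
  also have "\<dots> = (\<Sum>i\<in>UNIV. y $ i *\<^sub>R L (axis i 1))"
    using assms by (simp add: linear_sum linear_scale)
  finally show ?thesis .
qed

text \<open>Used to read off contracted derivatives: one function is written in two ways and the
  gradients are compared.\<close>

lemma has_gradsD_unique:
  assumes "has_grads H u v x y" "has_grads H u' v' x y"
  shows "u = u'" "v = v'"
  using partial_x_eq[OF assms(1)] partial_x_eq[OF assms(2)]
    partial_y_eq[OF assms(1)] partial_y_eq[OF assms(2)] by (simp_all add: vec_eq_iff)

section \<open>Rotation by a right angle\<close>

text \<open>From here on \<open>v_field\<close> serves as the linear rotation J, applied to tangent
  vectors and gradients as well as to points.\<close>

lemma v_field_component: "v_field w $ 1 = - (w $ 2)" "v_field w $ 2 = w $ 1"
  by (simp_all add: v_field_def)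

lemma v_field_v_field: "v_field (v_field w) = - w"
  by (simp add: vec_eq_iff forall_2 v_field_component)

lemma v_field_add: "v_field (v + w) = v_field v + v_field w"
  and v_field_diff: "v_field (v - w) = v_field v - v_field w"
  and v_field_scaleR: "v_field (c *\<^sub>R w) = c *\<^sub>R v_field w"
  by (simp_all add: vec_eq_iff forall_2 v_field_component)

lemma inner_v_field_self: "v_field w \<bullet> w = 0" "w \<bullet> v_field w = 0"
  by (simp_all add: inner_vec_def sum_2 v_field_component)

lemma inner_v_field_left: "v_field v \<bullet> w = - (v \<bullet> v_field w)"
  by (simp add: inner_vec_def sum_2 v_field_component)

lemma inner_v_field_v_field: "v_field v \<bullet> v_field w = v \<bullet> w"
  by (simp add: inner_vec_def sum_2 v_field_component)

lemma inner_axis_1: "axis i 1 \<bullet> w = w $ i" "w \<bullet> axis i (1::real) = w $ i"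
  by (simp_all add: inner_axis inner_axis')

lemma inner_v_field_axis: "v_field (axis i 1) \<bullet> w = - (v_field w $ i)" "w \<bullet> v_field (axis i 1) = - (v_field w $ i)"
  by (simp_all add: inner_v_field_left inner_axis_1) (metis inner_commute inner_v_field_left inner_axis_1(1))

section \<open>The metric in closed form\<close>

definition twist :: "real \<Rightarrow> real^2 \<Rightarrow> real^2" where
  "twist \<epsilon> p = p - \<epsilon> *\<^sub>R v_field p"

lemma twist_inner: "twist \<epsilon> p \<bullet> twist \<epsilon> p = (1 + \<epsilon>\<^sup>2) * ((p$1)\<^sup>2 + (p$2)\<^sup>2)"
  by (simp add: twist_def v_field_def inner_vec_def sum_2 power2_eq_square algebra_simps)

text \<open>\<open>twist \<epsilon>\<close> multiplies norms by sqrt (1 + \<epsilon>^2), so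
  \<open>\<rho>\<close> is the radius that it carries to 1.\<close>

lemma mem_disk_iff: "p \<in> disk (1 / sqrt (1 + \<epsilon>\<^sup>2)) \<longleftrightarrow> twist \<epsilon> p \<bullet> twist \<epsilon> p < 1"
proof -
  have "1 + \<epsilon>\<^sup>2 > 0" by (smt (verit) zero_le_power2)
  thus ?thesis by (simp add: disk_def twist_inner power_divide field_simps)
qed

text \<open>Multiplying |q + y / t|^2 = 1 by t^2 gives the quadratic equation D t^2 = 2 <q, y> t +
  |y|^2, of which t is the nonnegative root.\<close>

lemma funk_metric_root:
  assumes p: "p \<in> disk (1 / sqrt (1 + \<epsilon>\<^sup>2))" and t: "t > 0"
    and eq: "funk_metric p ((1 / t) *\<^sub>R y - \<epsilon> *\<^sub>R v_field p) = 1"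
  shows "t = (twist \<epsilon> p \<bullet> y + sqrt ((twist \<epsilon> p \<bullet> y)\<^sup>2 + (1 - twist \<epsilon> p \<bullet> twist \<epsilon> p) * (y \<bullet> y)))
        / (1 - twist \<epsilon> p \<bullet> twist \<epsilon> p)"
proof -
  define q where "q = twist \<epsilon> p"
  define D where "D = 1 - q \<bullet> q"
  have D: "D > 0" using p by (simp add: mem_disk_iff D_def q_def)
  have "((p$1)\<^sup>2 + (p$2)\<^sup>2) * 1 \<le> ((p$1)\<^sup>2 + (p$2)\<^sup>2) * (1 + \<epsilon>\<^sup>2)"
    by (rule mult_left_mono) auto
  hence "p \<in> disk 1" using D by (simp add: disk_def D_def q_def twist_inner mult.commute)
  from eq[unfolded funk_metric_eq_1_iff[OF this]]
  have "(q + (1 / t) *\<^sub>R y) \<bullet> (q + (1 / t) *\<^sub>R y) = 1"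
    by (simp add: q_def twist_def inner_vec_def sum_2 power2_eq_square algebra_simps)
  hence "q \<bullet> q + 2 * (q \<bullet> y) / t + (y \<bullet> y) / t\<^sup>2 = 1"
    by (simp add: inner_add_left inner_add_right inner_commute power2_eq_square)
  moreover have "t\<^sup>2 * (q \<bullet> q + 2 * (q \<bullet> y) / t + (y \<bullet> y) / t\<^sup>2)
      = t\<^sup>2 * (q \<bullet> q) + 2 * (q \<bullet> y) * t + y \<bullet> y"
    using t by (simp add: field_simps power2_eq_square)
  ultimately have quad: "D * t\<^sup>2 = 2 * (q \<bullet> y) * t + y \<bullet> y"
    by (simp add: D_def algebra_simps)
  \<comment> \<open>This fixes the sign of the square root: by the equation, t (D t - <q, y>) is
    half of D t^2 + |y|^2, hence positive.\<close>
  have "t * (D * t - q \<bullet> y) = (D * t\<^sup>2 + y \<bullet> y) / 2"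
    using quad by (simp add: power2_eq_square algebra_simps)
  also have "\<dots> > 0" using D t by (simp add: add_pos_nonneg)
  finally have pos: "D * t - q \<bullet> y \<ge> 0" using t by (simp add: zero_less_mult_iff)
  have "(D * t - q \<bullet> y)\<^sup>2 = D * (D * t\<^sup>2) - 2 * D * t * (q \<bullet> y) + (q \<bullet> y)\<^sup>2"
    by (simp add: power2_eq_square algebra_simps)
  also have "\<dots> = (q \<bullet> y)\<^sup>2 + D * (y \<bullet> y)"
    unfolding quad by (simp add: algebra_simps)
  finally have "sqrt ((q \<bullet> y)\<^sup>2 + D * (y \<bullet> y)) = D * t - q \<bullet> y"
    using pos by (intro real_sqrt_unique)
  thus ?thesis using D by (simp add: q_def[symmetric] D_def[symmetric])
qed

text \<open>The implicit equation is left behind here: all geometry uses the closed formula, assumed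
  only over the disk, and including y = 0, where it gives 0.\<close>

locale twisted_funk =
  fixes \<epsilon> \<rho> :: real and F :: "real^2 \<Rightarrow> real^2 \<Rightarrow> real"
  assumes rho: "\<rho> = 1 / sqrt (1 + \<epsilon>\<^sup>2)"
    and F_formula: "p \<in> disk \<rho> \<Longrightarrow> F p y =
      (twist \<epsilon> p \<bullet> y + sqrt ((twist \<epsilon> p \<bullet> y)\<^sup>2 + (1 - twist \<epsilon> p \<bullet> twist \<epsilon> p) * (y \<bullet> y)))
        / (1 - twist \<epsilon> p \<bullet> twist \<epsilon> p)"
begin

abbreviation q :: "real^2 \<Rightarrow> real^2" where "q \<equiv> twist \<epsilon>"

text \<open>\<open>cotwist\<close> is the transpose of \<open>q\<close>: it turns gradients with respect to \<open>q p\<close> into gradients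
  with respect to \<open>p\<close>.\<close>

definition cotwist :: "real^2 \<Rightarrow> real^2" where "cotwist w = w + \<epsilon> *\<^sub>R v_field w"

definition D :: "real^2 \<Rightarrow> real" where "D p = 1 - q p \<bullet> q p"

definition T :: "real^2 \<Rightarrow> real^2 \<Rightarrow> real" where "T p y = sqrt ((q p \<bullet> y)\<^sup>2 + D p * (y \<bullet> y))"

definition m :: "real^2 \<Rightarrow> real^2 \<Rightarrow> real^2" where "m p y = (1 / F p y) *\<^sub>R y"

definition n :: "real^2 \<Rightarrow> real^2 \<Rightarrow> real^2" where "n p y = q p + m p y"

definition \<kappa> :: "real^2 \<Rightarrow> real^2 \<Rightarrow> real" where "\<kappa> p y = n p y \<bullet> m p y"

definition f :: "real^2 \<Rightarrow> real^2 \<Rightarrow> real^2" where "f p y = (1 / \<kappa> p y) *\<^sub>R n p y"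

text \<open>The slit tangent bundle over the disk. At y = 0 the vector \<open>m\<close> would divide
  by F = 0.\<close>

definition W :: "((real^2) \<times> (real^2)) set" where "W = disk \<rho> \<times> (UNIV - {0})"

section \<open>Positivity and algebraic relations of the frame\<close>

lemma open_disk: "open (disk \<rho>)"
  unfolding disk_def by (intro open_Collect_less continuous_intros)

lemma open_W: "open W"
  unfolding W_def by (intro open_Times open_disk) auto

lemma disk_iff: "p \<in> disk \<rho> \<longleftrightarrow> D p > 0"
  by (simp add: rho mem_disk_iff D_def)

lemma F_eq': "p \<in> disk \<rho> \<Longrightarrow> F p y = (q p \<bullet> y + T p y) / D p"
  by (simp add: F_formula T_def D_def)

lemma radicand_pos:
  assumes "(p, y) \<in> W"
  shows "(q p \<bullet> y)\<^sup>2 + D p * (y \<bullet> y) > 0"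
  using assms disk_iff by (auto simp: W_def intro!: add_nonneg_pos mult_pos_pos)

lemma T_pos: "(p, y) \<in> W \<Longrightarrow> T p y > 0"
  unfolding T_def using radicand_pos by simp

lemma T_square: "p \<in> disk \<rho> \<Longrightarrow> T p y * T p y = (q p \<bullet> y)\<^sup>2 + D p * (y \<bullet> y)"
  using disk_iff[of p] by (simp add: T_def)

lemma F_pos: "(p, y) \<in> W \<Longrightarrow> F p y > 0"
proof -
  assume W: "(p, y) \<in> W"
  hence p: "p \<in> disk \<rho>" and D: "D p > 0" and y: "y \<bullet> y > 0" using disk_iff by (auto simp: W_def)
  have "\<bar>q p \<bullet> y\<bar> < T p y"
    unfolding T_def using D y by (intro real_less_rsqrt) simp
  thus ?thesis using D by (simp add: F_eq'[OF p])
qed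

lemma F_quadratic:
  assumes "p \<in> disk \<rho>"
  shows "y \<bullet> y + 2 * (q p \<bullet> y) * F p y = D p * (F p y)\<^sup>2"
proof -
  have "D p > 0" using assms disk_iff by simp
  thus ?thesis using T_square[OF assms, of y]
    by (simp add: F_eq'[OF assms] field_simps power2_eq_square)
qed

lemma q_eq: "q p = n p y - m p y" by (simp add: n_def)

lemma y_eq: "(p, y) \<in> W \<Longrightarrow> y = F p y *\<^sub>R m p y"
  using F_pos[of p y] by (simp add: m_def)

lemma m_quadratic:
  assumes "(p, y) \<in> W"
  shows "m p y \<bullet> m p y + 2 * (q p \<bullet> m p y) = D p"
proof -
  have p: "p \<in> disk \<rho>" and F: "F p y > 0" using assms F_pos by (auto simp: W_def)
  have "y \<bullet> y = (F p y)\<^sup>2 * (m p y \<bullet> m p y)" "q p \<bullet> y = F p y * (q p \<bullet> m p y)"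
    using F by (simp_all add: m_def power2_eq_square)
  hence "(F p y)\<^sup>2 * (m p y \<bullet> m p y + 2 * (q p \<bullet> m p y)) = (F p y)\<^sup>2 * D p"
    using F_quadratic[OF p, of y] by (simp add: algebra_simps power2_eq_square)
  thus ?thesis using F by simp
qed

lemma n_unit: "(p, y) \<in> W \<Longrightarrow> n p y \<bullet> n p y = 1"
  using m_quadratic[of p y]
  by (simp add: n_def inner_add_left inner_add_right D_def inner_commute)

lemma n_unit':
  assumes "(p, y) \<in> W"
  shows "n p y $ 1 * n p y $ 1 + n p y $ 2 * n p y $ 2 = 1"
  using n_unit[OF assms] by (simp add: inner_vec_def sum_2)

text \<open>\<open>T\<close> is D F - <q, y>, half the derivative of the quadratic polynomial of
  \<open>F_quadratic\<close> at its root F. Since <n, m> = 1 - <n, q>, this also reflects |q| <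
  1.\<close>

lemma T_eq:
  assumes "(p, y) \<in> W"
  shows "T p y = F p y * \<kappa> p y"
proof -
  have p: "p \<in> disk \<rho>" and F: "F p y > 0" and D: "D p > 0"
    using assms F_pos disk_iff by (auto simp: W_def)
  have "T p y = D p * F p y - q p \<bullet> y" using D by (simp add: F_eq'[OF p])
  also have "q p \<bullet> y = F p y * (q p \<bullet> m p y)" using F by (simp add: m_def)
  also have "D p * F p y - F p y * (q p \<bullet> m p y) = F p y * \<kappa> p y"
    unfolding m_quadratic[OF assms, symmetric]
    by (simp add: \<kappa>_def n_def inner_add_left algebra_simps)
  finally show ?thesis .
qed

lemma kappa_pos: "(p, y) \<in> W \<Longrightarrow> \<kappa> p y > 0"
  using T_eq T_pos F_pos by (metis zero_less_mult_pos)

lemma f_alt: "(p, y) \<in> W \<Longrightarrow> f p y = (1 / T p y) *\<^sub>R (y + F p y *\<^sub>R q p)"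
  using F_pos[of p y] kappa_pos[of p y]
  by (simp add: T_eq f_def n_def m_def algebra_simps)

section \<open>Gradients of \<open>q\<close>, \<open>D\<close> and \<open>F\<close>\<close>

lemma has_grads_q: "has_grads (\<lambda>p y. q p $ i) (cotwist (axis i 1)) 0 p y"
  by (cases i rule: exhaust_2[THEN disjE, rotated -1];
      (simp add: twist_def v_field_def,
        rule has_grads_eqI, (rule has_grads_intros)+,
        simp_all add: vec_eq_iff forall_2 cotwist_def v_field_def axis_def)?)

lemma has_grads_qy: "has_grads (\<lambda>p y. q p \<bullet> y) (cotwist y) (q p) p y"
  unfolding inner_vec_def sum_2 inner_real_def
  by (rule has_grads_eqI, (rule has_grads_intros has_grads_q)+)
     (simp_all add: vec_eq_iff forall_2 cotwist_def v_field_def axis_def algebra_simps)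

lemma has_grads_yy: "has_grads (\<lambda>p y. y \<bullet> y) 0 (2 *\<^sub>R y) p (y :: real^2)"
  unfolding inner_vec_def sum_2 inner_real_def
  by (rule has_grads_eqI, (rule has_grads_intros)+)
     (simp_all add: vec_eq_iff forall_2 axis_def algebra_simps)

lemma has_grads_D: "has_grads (\<lambda>p y. D p) (- 2 *\<^sub>R cotwist (q p)) 0 p y"
  unfolding inner_vec_def sum_2 inner_real_def D_def
  by (rule has_grads_eqI, (rule has_grads_intros has_grads_q)+)
     (simp_all add: vec_eq_iff forall_2 cotwist_def v_field_def axis_def algebra_simps)

lemma cotwist_add: "cotwist (v + w) = cotwist v + cotwist w"
  and cotwist_scaleR: "cotwist (c *\<^sub>R v) = c *\<^sub>R cotwist v"
  by (simp_all add: cotwist_def v_field_def vec_eq_iff forall_2 algebra_simps)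

text \<open>Implicit differentiation of |q + y / F| = 1 predicts the result: <n, dq + dy / F - m dF
  / F> = 0, so \<kappa> dF = F <n, dq> + <n, dy>. The proof differentiates the closed formula, which
  yields differentiability too.\<close>

lemma has_grads_F:
  assumes W: "(p, y) \<in> W"
  shows "has_grads F (F p y *\<^sub>R cotwist (f p y)) (f p y) p y"
proof -
  have p: "p \<in> disk \<rho>" and D: "D p > 0" using W disk_iff by (auto simp: W_def)
  have T: "T p y > 0" "y \<bullet> y = (T p y * T p y - (q p \<bullet> y)\<^sup>2) / D p"
    using T_pos[OF W] T_square[OF p, of y] D by simp_all
  have "has_grads (\<lambda>p y. (q p \<bullet> y + sqrt ((q p \<bullet> y) * (q p \<bullet> y) + D p * (y \<bullet> y))) / D p)
      (F p y *\<^sub>R cotwist (f p y)) (f p y) p y"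
  proof (rule has_grads_eqI[OF has_grads_divide[OF has_grads_add[OF has_grads_qy has_grads_sqrt[OF
        has_grads_add[OF has_grads_mult[OF has_grads_qy has_grads_qy] has_grads_mult[OF has_grads_D has_grads_yy]]]]
        has_grads_D]], goal_cases)
    case 1
    show ?case using radicand_pos[OF W] by (simp add: power2_eq_square)
  next
    case 2
    show ?case using D by simp
  next
    case 3
    show ?case
      unfolding T_def[symmetric, of p y, unfolded power2_eq_square] f_alt[OF W] cotwist_add cotwist_scaleR
        F_eq'[OF p]
      \<comment> \<open>Eliminating |y|^2 leaves an identity in which T, D and <q, y> can be treated
        as independent.\<close>
      unfolding T(2)
      using D T(1) by (simp add: vec_eq_iff field_simps power2_eq_square)
  next
    case 4
    show ?case
      unfolding T_def[symmetric, of p y, unfolded power2_eq_square] f_alt[OF W]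
        F_eq'[OF p]
      using D T(1) by (simp add: vec_eq_iff field_simps power2_eq_square)
  qed
  thus ?thesis
    by (rule has_grads_cong[OF open_W W, rotated])
       (auto simp: W_def F_formula D_def power2_eq_square)
qed

section \<open>The fundamental tensor and the spray\<close>

text \<open>Row i of the fundamental tensor F_y F_y^T + F F_yy. By homogeneity the Hessian F_yy
  annihilates m, so in dimension two it is a multiple of the square of J m.\<close>

definition gt :: "real^2 \<Rightarrow> real^2 \<Rightarrow> 2 \<Rightarrow> real^2" where
  "gt p y i = f p y $ i *\<^sub>R f p y + (v_field (m p y) $ i / \<kappa> p y ^ 3) *\<^sub>R v_field (m p y)"

lemma cotwist_diff: "cotwist (v - w) = cotwist v - cotwist w"
  by (simp add: cotwist_def v_field_diff algebra_simps)

lemma kappa_f: "(p, y) \<in> W \<Longrightarrow> n p y = \<kappa> p y *\<^sub>R f p y"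
  using kappa_pos[of p y] by (simp add: f_def)

lemma f_inner_m: "(p, y) \<in> W \<Longrightarrow> f p y \<bullet> m p y = 1"
  using kappa_pos[of p y] by (simp add: f_def \<kappa>_def)

section \<open>Gradients of \<open>m\<close>, \<open>n\<close>, \<open>\<kappa>\<close> and
  \<open>f\<close>\<close>

lemma has_grads_m:
  assumes W: "(p, y) \<in> W"
  shows "has_grads (\<lambda>p y. m p y $ i) (- (m p y $ i) *\<^sub>R cotwist (f p y))
    ((1 / F p y) *\<^sub>R (axis i 1 - m p y $ i *\<^sub>R f p y)) p y"
proof -
  have "has_grads (\<lambda>p y. y $ i / F p y) (- (m p y $ i) *\<^sub>R cotwist (f p y))
    ((1 / F p y) *\<^sub>R (axis i 1 - m p y $ i *\<^sub>R f p y)) p y"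
    using F_pos[OF W]
    by (intro has_grads_eqI[OF has_grads_divide[OF has_grads_snd has_grads_F[OF W]]])
       (simp_all add: m_def vec_eq_iff field_simps power2_eq_square)
  thus ?thesis by (simp add: m_def)
qed

lemma has_grads_n:
  assumes W: "(p, y) \<in> W"
  shows "has_grads (\<lambda>p y. n p y $ i) (cotwist (axis i 1 - m p y $ i *\<^sub>R f p y))
    ((1 / F p y) *\<^sub>R (axis i 1 - m p y $ i *\<^sub>R f p y)) p y"
  unfolding n_def
  using has_grads_add[OF has_grads_q has_grads_m[OF W], of i i]
  by (simp add: cotwist_diff cotwist_scaleR)

lemma has_grads_kappa:
  assumes W: "(p, y) \<in> W"
  shows "has_grads \<kappa> (cotwist (m p y - n p y - (m p y \<bullet> m p y) *\<^sub>R f p y))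
    ((1 / F p y) *\<^sub>R (m p y - (m p y \<bullet> m p y) *\<^sub>R f p y)) p y"
proof -
  have "has_grads (\<lambda>p y. n p y $ 1 * m p y $ 1 + n p y $ 2 * m p y $ 2)
    (cotwist (m p y - (n p y \<bullet> m p y) *\<^sub>R f p y - (m p y \<bullet> m p y) *\<^sub>R f p y))
    ((1 / F p y) *\<^sub>R ((n p y - (n p y \<bullet> m p y) *\<^sub>R f p y) + m p y - (m p y \<bullet> m p y) *\<^sub>R f p y)) p y"
    by (intro has_grads_eqI[OF has_grads_add[OF has_grads_mult has_grads_mult,
            OF has_grads_n[OF W] has_grads_m[OF W] has_grads_n[OF W] has_grads_m[OF W]]])
       (simp_all add: vec_eq_iff forall_2 inner_vec_def sum_2 axis_def cotwist_def v_field_component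
          divide_inverse algebra_simps)
  thus ?thesis
    unfolding \<kappa>_def[symmetric] kappa_f[OF W, symmetric]
    by (simp add: \<kappa>_def[abs_def] inner_vec_def sum_2)
qed

lemma frame_identity_aux:
  fixes n1 n2 m1 m2 :: real
  assumes "n1 * n1 + n2 * n2 = 1"
  shows "(n1 * m1 + n2 * m2)\<^sup>2 = m2 * m2 + 2 * (n1 * m1 + n2 * m2) * n1 * m1 - (m1 * m1 + m2 * m2) * n1 * n1"
    and "m1 * m2 = (n1 * m1 + n2 * m2) * (m1 * n2 + n1 * m2) - (m1 * m1 + m2 * m2) * n1 * n2"
  using assms unfolding power2_eq_square by algebra+

text \<open>As |n| = 1, the vector \<kappa> z - <n, z> m is orthogonal to n and equals <J m, z> J n.
  Taking squared norms gives the quadratic form of this identity. It serves to remove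
  \<open>axis i 1\<close> from the gradient of \<open>f\<close>.\<close>

lemma frame_identity:
  assumes W: "(p, y) \<in> W"
  shows "(\<kappa> p y)\<^sup>2 *\<^sub>R axis i 1 = v_field (m p y) $ i *\<^sub>R v_field (m p y)
    + (\<kappa> p y * m p y $ i) *\<^sub>R n p y + (\<kappa> p y * n p y $ i) *\<^sub>R m p y
    - ((m p y \<bullet> m p y) * n p y $ i) *\<^sub>R n p y"
proof -
  have *: "n p y $ 1 * n p y $ 1 + n p y $ 2 * n p y $ 2 = 1" by (rule n_unit'[OF W])
  \<comment> \<open>The second row follows from the same polynomial identities with the two
    coordinates exchanged.\<close>
  have **: "n p y $ 2 * n p y $ 2 + n p y $ 1 * n p y $ 1 = 1" using * by simp
  have \<kappa>: "\<kappa> p y = n p y $ 1 * m p y $ 1 + n p y $ 2 * m p y $ 2"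
    "\<kappa> p y = n p y $ 2 * m p y $ 2 + n p y $ 1 * m p y $ 1"
    by (simp_all add: \<kappa>_def inner_vec_def sum_2)
  have "i = 1 \<or> i = 2" by (rule exhaust_2)
  thus ?thesis
    using frame_identity_aux[OF *, of "m p y $ 1" "m p y $ 2", folded \<kappa>]
      frame_identity_aux[OF **, of "m p y $ 2" "m p y $ 1", folded \<kappa>]
    by (auto simp: vec_eq_iff forall_2 axis_def v_field_component inner_vec_def sum_2 algebra_simps)
qed

lemma has_grads_f:
  assumes W: "(p, y) \<in> W"
  shows "has_grads (\<lambda>p y. f p y $ i) (cotwist (gt p y i))
    ((v_field (m p y) $ i / (F p y * \<kappa> p y ^ 3)) *\<^sub>R v_field (m p y)) p y"
proof -
  note pos = F_pos[OF W] kappa_pos[OF W]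
  \<comment> \<open>After this substitution all terms except f_i f and (J m)_i J m cancel.\<close>
  have fr: "axis i 1 = (1 / (\<kappa> p y)\<^sup>2) *\<^sub>R (v_field (m p y) $ i *\<^sub>R v_field (m p y)
    + (\<kappa> p y * m p y $ i) *\<^sub>R n p y + (\<kappa> p y * n p y $ i) *\<^sub>R m p y
    - ((m p y \<bullet> m p y) * n p y $ i) *\<^sub>R n p y)"
    unfolding frame_identity[OF W, symmetric] using pos by simp
  have "has_grads (\<lambda>p y. n p y $ i / \<kappa> p y) (cotwist (gt p y i))
    ((v_field (m p y) $ i / (F p y * \<kappa> p y ^ 3)) *\<^sub>R v_field (m p y)) p y"
  proof (rule has_grads_eqI[OF has_grads_divide[OF has_grads_n[OF W] has_grads_kappa[OF W]]], goal_cases)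
    case 2
    show ?case unfolding cotwist_scaleR[symmetric] cotwist_diff[symmetric] fr
      unfolding gt_def f_def using pos
      by (intro arg_cong[where f = cotwist]) (simp add: vec_eq_iff field_simps power2_eq_square power3_eq_cube)
  next
    case 3
    show ?case unfolding fr
      unfolding gt_def f_def using pos
      by (simp add: vec_eq_iff field_simps power2_eq_square power3_eq_cube)
  qed (use pos in simp)
  thus ?thesis by (simp add: f_def)
qed

lemma has_grads_F_square:
  assumes W: "(p, y) \<in> W"
  shows "has_grads (\<lambda>p y. (F p y)\<^sup>2) ((2 * (F p y)\<^sup>2) *\<^sub>R cotwist (f p y)) ((2 * F p y) *\<^sub>R f p y) p y"
  using has_grads_mult[OF has_grads_F[OF W] has_grads_F[OF W]]
  by (simp add: power2_eq_square scaleR_left_distrib[symmetric])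

lemma has_grads_partial_y_F_square:
  assumes W: "(p, y) \<in> W"
  shows "has_grads (partial_y i (\<lambda>p y. (F p y)\<^sup>2))
     ((2 * F p y) *\<^sub>R cotwist (gt p y i) + (2 * F p y * f p y $ i) *\<^sub>R cotwist (f p y))
     (2 *\<^sub>R gt p y i) p y"
proof -
  have "has_grads (\<lambda>p y. 2 * (F p y * f p y $ i))
     ((2 * F p y) *\<^sub>R cotwist (gt p y i) + (2 * F p y * f p y $ i) *\<^sub>R cotwist (f p y))
     (2 *\<^sub>R gt p y i) p y"
    using F_pos[OF W]
    by (intro has_grads_eqI[OF has_grads_mult[OF has_grads_const has_grads_mult[OF has_grads_F[OF W] has_grads_f[OF W]]]])
       (simp_all add: gt_def algebra_simps)
  thus ?thesis
    by (rule has_grads_cong[OF open_W W, rotated]) (simp add: partial_y_eq[OF has_grads_F_square])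
qed

lemma fundamental_tensor_eq: "(p, y) \<in> W \<Longrightarrow> fundamental_tensor F p y $ i $ j = gt p y i $ j"
  unfolding fundamental_tensor_def by (simp add: partial_y_eq[OF has_grads_partial_y_F_square])

lemma gt_symmetric: "gt p y i $ j = gt p y j $ i"
  by (simp add: gt_def)

text \<open>Euler's relation g y = F F_y, scaled by 1 / F: the summand J m is orthogonal to m, and
  <f, m> = 1.\<close>

lemma gt_inner_m: "(p, y) \<in> W \<Longrightarrow> gt p y i \<bullet> m p y = f p y $ i"
  by (simp add: gt_def inner_add_left f_inner_m inner_v_field_self)

lemma fundamental_tensor_pos_def:
  assumes W: "(p, y) \<in> W"
  shows "pos_def_matrix (fundamental_tensor F p y)"
  unfolding pos_def_matrix_def
proof (intro conjI allI impI)
  show "transpose (fundamental_tensor F p y) = fundamental_tensor F p y"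
    by (simp add: vec_eq_iff transpose_def fundamental_tensor_eq[OF W] gt_symmetric)
next
  fix z :: "real^2" assume z: "z \<noteq> 0"
  note pos = kappa_pos[OF W]
  have eq: "z \<bullet> (fundamental_tensor F p y *v z) =
      (f p y \<bullet> z)\<^sup>2 + (v_field (m p y) \<bullet> z)\<^sup>2 / \<kappa> p y ^ 3"
    by (simp add: inner_vec_def matrix_vector_mult_def sum_2 fundamental_tensor_eq[OF W] gt_def
        power2_eq_square add_divide_distrib algebra_simps)
  \<comment> \<open>A common zero is parallel to m, and <f, m> = 1 forces it to vanish.\<close>
  have "f p y \<bullet> z \<noteq> 0 \<or> v_field (m p y) \<bullet> z \<noteq> 0"
  proof (rule ccontr)
    assume "\<not> ?thesis"
    hence "f p y $ 1 * z $ 1 + f p y $ 2 * z $ 2 = 0" "m p y $ 1 * z $ 2 = m p y $ 2 * z $ 1"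
      "f p y $ 1 * m p y $ 1 + f p y $ 2 * m p y $ 2 = 1"
      using f_inner_m[OF W] by (simp_all add: inner_vec_def sum_2 v_field_component)
    hence "z $ 1 = 0" "z $ 2 = 0" by algebra+
    thus False using z by (simp add: vec_eq_iff forall_2)
  qed
  thus "0 < z \<bullet> (fundamental_tensor F p y *v z)"
    unfolding eq using pos by (auto intro: add_nonneg_pos add_pos_nonneg)
qed

section \<open>The spray in closed form\<close>

definition G :: "real^2 \<Rightarrow> real^2 \<Rightarrow> real^2" where
  "G p y = (F p y / 2) *\<^sub>R y - (\<epsilon> * F p y) *\<^sub>R v_field y - (\<epsilon> * (F p y)\<^sup>2 / 2) *\<^sub>R v_field (q p)"

lemma G_alt:
  assumes "(p, y) \<in> W"
  shows "G p y = ((F p y)\<^sup>2 / 2) *\<^sub>R (m p y - \<epsilon> *\<^sub>R v_field (m p y) - \<epsilon> *\<^sub>R v_field (n p y))"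
proof -
  have "G p y = (F p y / 2) *\<^sub>R (F p y *\<^sub>R m p y) - (\<epsilon> * F p y) *\<^sub>R v_field (F p y *\<^sub>R m p y)
    - (\<epsilon> * (F p y)\<^sup>2 / 2) *\<^sub>R v_field (n p y - m p y)"
    unfolding G_def y_eq[OF assms, symmetric] q_eq[symmetric] ..
  thus ?thesis
    by (simp add: v_field_diff v_field_scaleR vec_eq_iff power2_eq_square algebra_simps)
qed

text \<open>Multiplied by \<kappa>^2 this is the expansion of J m in the orthonormal frame n, J n,
  where <J n, J m> = \<kappa>.\<close>

lemma frame_identity':
  assumes W: "(p, y) \<in> W"
  shows "f p y $ k * (f p y \<bullet> v_field (m p y)) + v_field (f p y) $ k = v_field (m p y) $ k / (\<kappa> p y)\<^sup>2"
proof -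
  have *: "n p y $ 1 * n p y $ 1 + n p y $ 2 * n p y $ 2 = 1" by (rule n_unit'[OF W])
  have k: "\<kappa> p y > 0" by (rule kappa_pos[OF W])
  have \<kappa>: "\<kappa> p y = n p y $ 1 * m p y $ 1 + n p y $ 2 * m p y $ 2"
    by (simp_all add: \<kappa>_def inner_vec_def sum_2)
  have "m p y $ 2 = n p y $ 1 * (n p y $ 1 * m p y $ 2 - n p y $ 2 * m p y $ 1) + \<kappa> p y * n p y $ 2"
    "m p y $ 1 = n p y $ 2 * (n p y $ 2 * m p y $ 1 - n p y $ 1 * m p y $ 2) + \<kappa> p y * n p y $ 1"
    using * unfolding \<kappa> by algebra+
  hence "n p y $ k * (n p y \<bullet> v_field (m p y)) + \<kappa> p y * v_field (n p y) $ k = v_field (m p y) $ k"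
    using exhaust_2[of k]
    by (auto simp: v_field_component inner_vec_def sum_2 algebra_simps)
  thus ?thesis unfolding f_def v_field_scaleR using k
    by (simp add: field_simps power2_eq_square)
qed

text \<open>Existence suffices here: the values of these gradients are needed only after contraction
  with y, and then they come from simpler functions.\<close>

lemma has_grads_gt:
  assumes W: "(p, y) \<in> W"
  shows "\<exists>u v. has_grads (\<lambda>p y. gt p y i $ j) u v p y"
proof -
  have J: "\<exists>u v. has_grads (\<lambda>p y. v_field (m p y) $ i) u v p y" for i
    using has_grads_minus[OF has_grads_m[OF W]] has_grads_m[OF W] exhaust_2[of i]
    by (auto simp: v_field_component; blast)
  obtain u v u' v' where Jij: "has_grads (\<lambda>p y. v_field (m p y) $ i) u v p y"
     "has_grads (\<lambda>p y. v_field (m p y) $ j) u' v' p y" using J by metis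
  have k: "\<kappa> p y * \<kappa> p y * \<kappa> p y \<noteq> 0" using kappa_pos[OF W] by simp
  note kap = has_grads_kappa[OF W]
  have eq: "gt p y i $ j = f p y $ i * f p y $ j
      + v_field (m p y) $ i / (\<kappa> p y * \<kappa> p y * \<kappa> p y) * v_field (m p y) $ j" for p y
    by (simp add: gt_def power3_eq_cube)
  show ?thesis unfolding eq
    using has_grads_add[OF has_grads_mult[OF has_grads_f[OF W, of i] has_grads_f[OF W, of j]]
       has_grads_mult[OF has_grads_divide[OF Jij(1) has_grads_mult[OF has_grads_mult[OF kap kap] kap] k] Jij(2)]]
    by blast
qed

theorem geodesic_coeff_eq:
  assumes W: "(p, y) \<in> W"
  shows "geodesic_coeff F i p y = G p y $ i"
proof -
  obtain U V where UV: "\<And>i j. has_grads (\<lambda>p y. gt p y i $ j) (U i j) (V i j) p y"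
    using has_grads_gt[OF W] by metis
  have px: "partial_x k (\<lambda>p y. fundamental_tensor F p y $ i $ j) p y = U i j $ k" for i j k
    by (rule partial_x_eq[OF has_grads_cong[OF open_W W _ UV]]) (simp add: fundamental_tensor_eq)
  \<comment> \<open>The x-gradient, at fixed y, of the identity (g y)_k = F f_k.\<close>
  have Uk: "(\<Sum>i\<in>UNIV. y $ i *\<^sub>R U i k) = F p y *\<^sub>R cotwist (gt p y k) + (F p y * f p y $ k) *\<^sub>R cotwist (f p y)" for k
  proof -
    have H: "has_grads (\<lambda>p y. y $ 1 * gt p y 1 $ k + y $ 2 * gt p y 2 $ k)
      (y $ 1 *\<^sub>R U 1 k + gt p y 1 $ k *\<^sub>R 0 + (y $ 2 *\<^sub>R U 2 k + gt p y 2 $ k *\<^sub>R 0))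
      (y $ 1 *\<^sub>R V 1 k + gt p y 1 $ k *\<^sub>R axis 1 1 + (y $ 2 *\<^sub>R V 2 k + gt p y 2 $ k *\<^sub>R axis 2 1)) p y"
      by (intro has_grads_add has_grads_mult UV has_grads_snd)
    have E: "y $ 1 * gt p y 1 $ k + y $ 2 * gt p y 2 $ k = F p y * f p y $ k" if "(p, y) \<in> W" for p y
    proof -
      have "y $ 1 * gt p y 1 $ k + y $ 2 * gt p y 2 $ k = gt p y k \<bullet> y"
        by (simp add: inner_vec_def sum_2 gt_symmetric[of p y k] mult.commute)
      also have "\<dots> = F p y * (gt p y k \<bullet> m p y)" by (subst y_eq[OF that]) simp
      finally show ?thesis by (simp add: gt_inner_m[OF that])
    qed
    from has_gradsD_unique(1)[OF has_grads_cong[OF open_W W E H] has_grads_mult[OF has_grads_F[OF W] has_grads_f[OF W]]]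
    show ?thesis by (simp add: sum_2)
  qed
  \<comment> \<open>The x-gradient, at fixed y, of <y, g y> = F^2.\<close>
  have Ukk: "(\<Sum>i\<in>UNIV. \<Sum>j\<in>UNIV. (y $ i * y $ j) *\<^sub>R U i j) = (2 * (F p y)\<^sup>2) *\<^sub>R cotwist (f p y)"
  proof -
    have H: "has_grads (\<lambda>p y. (y $ 1 * y $ 1) * gt p y 1 $ 1 + (y $ 1 * y $ 2) * gt p y 1 $ 2
         + ((y $ 2 * y $ 1) * gt p y 2 $ 1 + (y $ 2 * y $ 2) * gt p y 2 $ 2))
      ((y $ 1 * y $ 1) *\<^sub>R U 1 1 + (y $ 1 * y $ 2) *\<^sub>R U 1 2
         + ((y $ 2 * y $ 1) *\<^sub>R U 2 1 + (y $ 2 * y $ 2) *\<^sub>R U 2 2))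
      (((y $ 1 * y $ 1) *\<^sub>R V 1 1 + gt p y 1 $ 1 *\<^sub>R (y $ 1 *\<^sub>R axis 1 1 + y $ 1 *\<^sub>R axis 1 1))
        + ((y $ 1 * y $ 2) *\<^sub>R V 1 2 + gt p y 1 $ 2 *\<^sub>R (y $ 1 *\<^sub>R axis 2 1 + y $ 2 *\<^sub>R axis 1 1))
        + (((y $ 2 * y $ 1) *\<^sub>R V 2 1 + gt p y 2 $ 1 *\<^sub>R (y $ 2 *\<^sub>R axis 1 1 + y $ 1 *\<^sub>R axis 2 1))
        + ((y $ 2 * y $ 2) *\<^sub>R V 2 2 + gt p y 2 $ 2 *\<^sub>R (y $ 2 *\<^sub>R axis 2 1 + y $ 2 *\<^sub>R axis 2 1)))) p y"
      by (rule has_grads_eqI, (rule has_grads_add has_grads_mult UV has_grads_snd)+) simp_all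
    have E: "(y $ 1 * y $ 1) * gt p y 1 $ 1 + (y $ 1 * y $ 2) * gt p y 1 $ 2
         + ((y $ 2 * y $ 1) * gt p y 2 $ 1 + (y $ 2 * y $ 2) * gt p y 2 $ 2) = (F p y)\<^sup>2" if "(p, y) \<in> W" for p y
    proof -
      have "(y $ 1 * y $ 1) * gt p y 1 $ 1 + (y $ 1 * y $ 2) * gt p y 1 $ 2
         + ((y $ 2 * y $ 1) * gt p y 2 $ 1 + (y $ 2 * y $ 2) * gt p y 2 $ 2)
         = y $ 1 * (gt p y 1 \<bullet> y) + y $ 2 * (gt p y 2 \<bullet> y)"
        by (simp add: inner_vec_def sum_2 algebra_simps)
      also have "\<dots> = F p y * (f p y \<bullet> y)"
      proof -
        have "gt p y k \<bullet> y = F p y * (gt p y k \<bullet> m p y)" for k by (subst y_eq[OF that]) simp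
        thus ?thesis
          unfolding gt_inner_m[OF that] by (simp add: inner_vec_def sum_2 algebra_simps)
      qed
      also have "f p y \<bullet> y = F p y * (f p y \<bullet> m p y)" by (subst y_eq[OF that]) simp
      finally show ?thesis by (simp add: f_inner_m[OF that] power2_eq_square)
    qed
    from has_gradsD_unique(1)[OF has_grads_cong[OF open_W W E H] has_grads_F_square[OF W]]
    show ?thesis by (simp add: sum_2)
  qed
  \<comment> \<open>The spray with its index lowered; it remains to recognise it as g applied to
    \<open>G\<close>.\<close>
  define e where "e k = 1/4 * (\<Sum>i\<in>UNIV. \<Sum>j\<in>UNIV. (2 * U i k $ j - U i j $ k) * y $ i * y $ j)" for k
  have e: "e k = 1/2 * (y \<bullet> (\<Sum>i\<in>UNIV. y $ i *\<^sub>R U i k))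
      - 1/4 * (\<Sum>i\<in>UNIV. \<Sum>j\<in>UNIV. (y $ i * y $ j) *\<^sub>R U i j) $ k" for k
    by (simp add: e_def sum_2 inner_vec_def algebra_simps)
  have eG: "e k = gt p y k \<bullet> G p y" for k
  proof -
    have 1: "y \<bullet> cotwist w = F p y * (w \<bullet> m p y - \<epsilon> * (w \<bullet> v_field (m p y)))" for w
      by (subst y_eq[OF W])
        (simp add: cotwist_def inner_add_right inner_commute inner_v_field_left)
    \<comment> \<open>The summand f is a multiple of n, hence orthogonal to J n, and <J m, J n> =
      \<kappa> cancels one of the three powers of \<kappa>.\<close>
    have 2: "gt p y k \<bullet> v_field (n p y) = v_field (m p y) $ k / (\<kappa> p y)\<^sup>2"
      using kappa_pos[OF W]
      by (simp add: gt_def inner_add_left inner_v_field_v_field f_def inner_v_field_self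
          inner_commute[of "m p y"] \<kappa>_def[symmetric] power2_eq_square power3_eq_cube)
    show ?thesis
      unfolding e Uk Ukk G_alt[OF W] inner_add_right inner_scaleR_right 1 inner_diff_right 2
        gt_inner_m[OF W] frame_identity'[OF W, of k, symmetric]
      by (simp add: f_inner_m[OF W] cotwist_def power2_eq_square algebra_simps)
  qed
  have "geodesic_coeff F i p y = (matrix_inv (fundamental_tensor F p y) *v vec_lambda e) $ i"
    unfolding geodesic_coeff_def px e_def matrix_vector_mult_def
    by (simp add: sum_2 algebra_simps)
  also have "vec_lambda e = fundamental_tensor F p y *v G p y"
    by (simp add: vec_eq_iff eG matrix_vector_mult_def inner_vec_def fundamental_tensor_eq[OF W])
  finally show ?thesis
    by (simp add: matrix_inv_mult_cancel[OF pos_def_matrix_invertible[OF fundamental_tensor_pos_def[OF W]]])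
qed

section \<open>Flag curvature\<close>

text \<open>The minus sign here, and in the next two gradients, is the antisymmetry of J: the
  transpose of J is - J.\<close>

lemma has_grads_Jy: "has_grads (\<lambda>p y. v_field y $ i) 0 (- v_field (axis i 1)) p y"
proof -
  have "i = 1 \<or> i = 2" by (rule exhaust_2)
  thus ?thesis
  proof
    assume i: "i = 1"
    show ?thesis unfolding i v_field_component
      by (intro has_grads_eqI[OF has_grads_minus[OF has_grads_snd]])
         (simp_all add: vec_eq_iff forall_2 v_field_component axis_def)
  next
    assume i: "i = 2"
    show ?thesis unfolding i v_field_component
      by (intro has_grads_eqI[OF has_grads_snd])
         (simp_all add: vec_eq_iff forall_2 v_field_component axis_def)
  qed
qed

lemma has_grads_Jq: "has_grads (\<lambda>p y. v_field (q p) $ i) (- cotwist (v_field (axis i 1))) 0 p y"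
proof -
  have "i = 1 \<or> i = 2" by (rule exhaust_2)
  thus ?thesis
  proof
    assume i: "i = 1"
    show ?thesis unfolding i v_field_component
      by (intro has_grads_eqI[OF has_grads_minus[OF has_grads_q]])
         (simp_all add: vec_eq_iff forall_2 v_field_component axis_def cotwist_def)
  next
    assume i: "i = 2"
    show ?thesis unfolding i v_field_component
      by (intro has_grads_eqI[OF has_grads_q])
         (simp_all add: vec_eq_iff forall_2 v_field_component axis_def cotwist_def)
  qed
qed

lemma has_grads_Jn:
  assumes W: "(p, y) \<in> W"
  shows "has_grads (\<lambda>p y. v_field (n p y) $ i)
    (- cotwist (v_field (axis i 1) + v_field (m p y) $ i *\<^sub>R f p y))
    (- (1 / F p y) *\<^sub>R (v_field (axis i 1) + v_field (m p y) $ i *\<^sub>R f p y)) p y"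
proof -
  have "i = 1 \<or> i = 2" by (rule exhaust_2)
  thus ?thesis
  proof
    assume i: "i = 1"
    show ?thesis unfolding i v_field_component
      by (intro has_grads_eqI[OF has_grads_minus[OF has_grads_n[OF W]]])
         (simp_all add: vec_eq_iff forall_2 v_field_component axis_def cotwist_def algebra_simps)
  next
    assume i: "i = 2"
    show ?thesis unfolding i v_field_component
      by (intro has_grads_eqI[OF has_grads_n[OF W]])
         (simp_all add: vec_eq_iff forall_2 v_field_component axis_def cotwist_def algebra_simps)
  qed
qed

text \<open>F c is the derivative of the formula for \<open>G\<close> with respect to F at fixed p
  and y; it uses J q + J m = J n.\<close>

definition c :: "real^2 \<Rightarrow> real^2 \<Rightarrow> real^2" where
  "c p y = (1/2) *\<^sub>R m p y - \<epsilon> *\<^sub>R v_field (n p y)"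

text \<open>The y-gradient of the i-th spray coefficient divided by F. The first two summands come
  from differentiating y and J y, the last from F_y = f.\<close>

definition X :: "2 \<Rightarrow> real^2 \<Rightarrow> real^2 \<Rightarrow> real^2" where
  "X i p y = (1/2) *\<^sub>R axis i 1 + \<epsilon> *\<^sub>R v_field (axis i 1) + c p y $ i *\<^sub>R f p y"

lemma has_grads_c:
  assumes W: "(p, y) \<in> W"
  shows "has_grads (\<lambda>p y. c p y $ i)
    (cotwist (\<epsilon> *\<^sub>R v_field (axis i 1) + (\<epsilon> * v_field (m p y) $ i - m p y $ i / 2) *\<^sub>R f p y))
    ((1 / F p y) *\<^sub>R ((1/2) *\<^sub>R axis i 1 + \<epsilon> *\<^sub>R v_field (axis i 1)
        + (\<epsilon> * v_field (m p y) $ i - m p y $ i / 2) *\<^sub>R f p y)) p y"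
proof -
  have "has_grads (\<lambda>p y. (1/2) * m p y $ i - \<epsilon> * v_field (n p y) $ i)
    (cotwist (\<epsilon> *\<^sub>R v_field (axis i 1) + (\<epsilon> * v_field (m p y) $ i - m p y $ i / 2) *\<^sub>R f p y))
    ((1 / F p y) *\<^sub>R ((1/2) *\<^sub>R axis i 1 + \<epsilon> *\<^sub>R v_field (axis i 1)
        + (\<epsilon> * v_field (m p y) $ i - m p y $ i / 2) *\<^sub>R f p y)) p y"
    using F_pos[OF W]
    by (intro has_grads_eqI[OF has_grads_diff[OF has_grads_mult[OF has_grads_const has_grads_m[OF W]]
            has_grads_mult[OF has_grads_const has_grads_Jn[OF W]]]])
       (simp_all add: vec_eq_iff cotwist_add cotwist_scaleR field_simps)
  thus ?thesis by (simp add: c_def)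
qed

lemma has_grads_geodesic_coeff:
  assumes W: "(p, y) \<in> W"
  shows "has_grads (geodesic_coeff F i)
    ((F p y)\<^sup>2 *\<^sub>R cotwist (c p y $ i *\<^sub>R f p y + (\<epsilon> / 2) *\<^sub>R v_field (axis i 1)))
    (F p y *\<^sub>R X i p y) p y"
proof -
  have c: "c p y $ i = m p y $ i / 2 - \<epsilon> * (v_field (q p) $ i + v_field (m p y) $ i)"
    by (simp add: c_def n_def v_field_add)
  have y: "y $ i = F p y * m p y $ i" "v_field y $ i = F p y * v_field (m p y) $ i"
    using y_eq[OF W] v_field_scaleR by (metis vector_scaleR_component real_scaleR_def)+
  have "has_grads (\<lambda>p y. (1/2) * (F p y * y $ i) - \<epsilon> * (F p y * v_field y $ i)
      - (\<epsilon>/2) * ((F p y)\<^sup>2 * v_field (q p) $ i))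
    ((F p y)\<^sup>2 *\<^sub>R cotwist (c p y $ i *\<^sub>R f p y + (\<epsilon> / 2) *\<^sub>R v_field (axis i 1)))
    (F p y *\<^sub>R X i p y) p y"
    by (intro has_grads_eqI[OF has_grads_diff[OF has_grads_diff[OF
       has_grads_mult[OF has_grads_const has_grads_mult[OF has_grads_F[OF W] has_grads_snd]]
       has_grads_mult[OF has_grads_const has_grads_mult[OF has_grads_F[OF W] has_grads_Jy]]]
       has_grads_mult[OF has_grads_const has_grads_mult[OF has_grads_F_square[OF W] has_grads_Jq]]]])
       (simp_all add: vec_eq_iff cotwist_add cotwist_scaleR X_def c y power2_eq_square,
        simp_all add: field_simps)
  thus ?thesis
    by (rule has_grads_cong[OF open_W W, rotated]) (simp add: geodesic_coeff_eq G_def algebra_simps)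
qed

lemma has_grads_partial_y_geodesic_coeff:
  assumes W: "(p, y) \<in> W"
  shows "has_grads (partial_y k (geodesic_coeff F i))
    (X i p y $ k *\<^sub>R (F p y *\<^sub>R cotwist (f p y)) + F p y *\<^sub>R (c p y $ i *\<^sub>R cotwist (gt p y k) + f p y $ k *\<^sub>R
      cotwist (\<epsilon> *\<^sub>R v_field (axis i 1) + (\<epsilon> * v_field (m p y) $ i - m p y $ i / 2) *\<^sub>R f p y)))
    (X i p y $ k *\<^sub>R f p y + (c p y $ i * v_field (m p y) $ k / \<kappa> p y ^ 3) *\<^sub>R v_field (m p y) + f p y $ k *\<^sub>R
       ((1/2) *\<^sub>R axis i 1 + \<epsilon> *\<^sub>R v_field (axis i 1)
        + (\<epsilon> * v_field (m p y) $ i - m p y $ i / 2) *\<^sub>R f p y)) p y"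
proof -
  have "has_grads (\<lambda>p y. F p y * (((1/2) *\<^sub>R axis i 1 + \<epsilon> *\<^sub>R v_field (axis i 1)) $ k + c p y $ i * f p y $ k))
    (X i p y $ k *\<^sub>R (F p y *\<^sub>R cotwist (f p y)) + F p y *\<^sub>R (c p y $ i *\<^sub>R cotwist (gt p y k) + f p y $ k *\<^sub>R
      cotwist (\<epsilon> *\<^sub>R v_field (axis i 1) + (\<epsilon> * v_field (m p y) $ i - m p y $ i / 2) *\<^sub>R f p y)))
    (X i p y $ k *\<^sub>R f p y + (c p y $ i * v_field (m p y) $ k / \<kappa> p y ^ 3) *\<^sub>R v_field (m p y) + f p y $ k *\<^sub>R
       ((1/2) *\<^sub>R axis i 1 + \<epsilon> *\<^sub>R v_field (axis i 1)
        + (\<epsilon> * v_field (m p y) $ i - m p y $ i / 2) *\<^sub>R f p y)) p y"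
    using F_pos[OF W] kappa_pos[OF W]
    by (intro has_grads_eqI[OF has_grads_mult[OF has_grads_F[OF W] has_grads_add[OF has_grads_const
        has_grads_mult[OF has_grads_c[OF W] has_grads_f[OF W]]]]])
       (simp_all add: vec_eq_iff X_def, simp_all add: field_simps)
  thus ?thesis
    by (rule has_grads_cong[OF open_W W, rotated])
       (simp add: partial_y_eq[OF has_grads_geodesic_coeff] X_def)
qed

lemma inner_sum_2: "(\<Sum>j\<in>UNIV. v $ j * w $ j) = v \<bullet> (w :: real^2)"
  by (simp add: inner_vec_def)

theorem constant_curvature: "constant_curvature_on (disk \<rho>) F (- 1/4)"
  unfolding constant_curvature_on_def
proof (intro ballI allI impI)
  fix p y :: "real^2" and i k :: 2
  assume "p \<in> disk \<rho>" "y \<noteq> 0"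
  hence W: "(p, y) \<in> W" by (simp add: W_def)
  define \<phi> where "\<phi> = f p y"
  define \<mu> where "\<mu> = m p y"
  define \<nu> where "\<nu> = n p y"
  define \<Phi> where "\<Phi> = F p y"
  define \<gamma> where "\<gamma> = c p y"
  define k3 where "k3 = 1 / \<kappa> p y ^ 3"
  have y: "y = \<Phi> *\<^sub>R \<mu>" unfolding \<Phi>_def \<mu>_def by (rule y_eq[OF W])
  have \<gamma>: "\<gamma> = (1/2) *\<^sub>R \<mu> - \<epsilon> *\<^sub>R v_field \<nu>" by (simp add: \<gamma>_def \<mu>_def \<nu>_def c_def)
  have fm: "\<phi> \<bullet> \<mu> = 1" unfolding \<phi>_def \<mu>_def by (rule f_inner_m[OF W])
  have fn: "\<phi> \<bullet> v_field \<nu> = 0" by (simp add: \<phi>_def f_def \<nu>_def inner_v_field_self)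
  have mu_cot: "\<mu> \<bullet> cotwist w = (\<mu> - \<epsilon> *\<^sub>R v_field \<mu>) \<bullet> w" for w
    by (simp add: cotwist_def inner_add_right inner_diff_left inner_v_field_left)
  \<comment> \<open>\<open>d_F\<close>, \<open>d_c\<close> and \<open>d_f\<close> are the derivatives of \<open>F\<close>, \<open>c\<close> and \<open>f\<close> along the spray.\<close>
  define s where "s = \<mu> - \<epsilon> *\<^sub>R v_field \<mu> - \<epsilon> *\<^sub>R v_field \<nu>"
  have G: "2 * geodesic_coeff F j p y = \<Phi>\<^sup>2 * s $ j" for j
    by (simp add: geodesic_coeff_eq[OF W] G_alt[OF W] s_def \<Phi>_def \<mu>_def \<nu>_def)
  have d_F: "- (\<mu> \<bullet> cotwist \<phi>) + s \<bullet> \<phi> = 0"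
    using fn unfolding mu_cot s_def by (simp add: inner_diff_left inner_commute[of \<phi>])
  \<comment> \<open>By \<open>has_grads_c\<close> the gradients of c_i are \<open>cotwist w\<close>
    in x and (1/2 e_i + w) / F in y.\<close>
  define w where "w = \<epsilon> *\<^sub>R v_field (axis i 1) + (\<epsilon> * v_field \<mu> $ i - \<mu> $ i / 2) *\<^sub>R \<phi>"
  have d_c: "- (\<mu> \<bullet> cotwist w) + s \<bullet> ((1/2) *\<^sub>R axis i 1 + w)
      = \<mu> $ i / 2 - \<epsilon> / 2 * v_field \<mu> $ i - \<epsilon> / 2 * v_field \<nu> $ i - \<epsilon>\<^sup>2 * \<nu> $ i"
  proof -
    have "v_field \<nu> \<bullet> w = \<epsilon> * \<nu> $ i"
      using fn by (simp add: w_def inner_add_right inner_v_field_v_field inner_axis_1 inner_commute[of _ \<phi>])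
    thus ?thesis unfolding mu_cot s_def
      by (simp add: inner_diff_left inner_add_right inner_axis_1 power2_eq_square algebra_simps)
  qed
  have d_f: "- (\<mu> \<bullet> cotwist (gt p y k)) + s \<bullet> ((v_field \<mu> $ k * k3) *\<^sub>R v_field \<mu>) = - \<phi> $ k - \<epsilon> * v_field \<phi> $ k"
  proof -
    have *: "\<mu> \<bullet> gt p y k = \<phi> $ k" using gt_inner_m[OF W] by (simp add: \<mu>_def \<phi>_def inner_commute)
    have **: "v_field \<mu> \<bullet> gt p y k = \<phi> $ k * (\<phi> \<bullet> v_field \<mu>) + v_field \<mu> $ k * k3 * (\<mu> \<bullet> \<mu>)"
      by (simp add: gt_def \<mu>_def \<phi>_def k3_def inner_add_right inner_v_field_v_field inner_commute)
    have "k3 * (\<nu> \<bullet> \<mu>) = 1 / (\<kappa> p y)\<^sup>2" using kappa_pos[OF W]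
      by (simp add: k3_def \<mu>_def \<nu>_def \<kappa>_def[symmetric] power2_eq_square power3_eq_cube)
    hence ***: "\<epsilon> * (v_field \<mu> $ k * k3 * (\<nu> \<bullet> \<mu>)) = \<epsilon> * (\<phi> $ k * (\<phi> \<bullet> v_field \<mu>) + v_field \<phi> $ k)"
      using frame_identity'[OF W, of k] by (simp add: \<mu>_def \<phi>_def mult.assoc)
    show ?thesis unfolding mu_cot s_def using ***
      by (simp add: inner_diff_left * ** inner_v_field_v_field inner_v_field_self algebra_simps)
  qed
  have phi_gamma: "\<phi> \<bullet> \<gamma> = 1/2" using fm fn by (simp add: \<gamma> inner_diff_right)
  have Xik: "X i p y $ k = (if i = k then 1/2 else 0) + \<epsilon> * v_field (axis i 1) $ k + \<gamma> $ i * \<phi> $ k" for i k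
    by (simp add: X_def \<gamma>_def \<phi>_def axis_def)
  have X_square: "(\<Sum>j\<in>UNIV. X i p y $ j * X j p y $ k)
      = X i p y $ k / 2 + \<epsilon> * (v_field (axis i 1) $ k / 2 - \<epsilon> * (if i = k then 1 else 0) + \<gamma> $ i * v_field \<phi> $ k)
        + (\<gamma> $ i - \<epsilon> * v_field \<gamma> $ i) * \<phi> $ k"
  proof -
    \<comment> \<open>Antisymmetry of J moves the summation index j to the component, so the sum
      over j becomes inner products with the row \<open>X i p y\<close>.\<close>
    have "X j p y $ k = (if j = k then 1/2 else 0) - \<epsilon> * v_field (axis k 1) $ j + \<gamma> $ j * \<phi> $ k" for j
      using exhaust_2[of j] exhaust_2[of k] unfolding Xik by (auto simp: v_field_component axis_def)
    hence "(\<Sum>j\<in>UNIV. X i p y $ j * X j p y $ k) = (\<Sum>j\<in>UNIV. X i p y $ j *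
        ((if j = k then 1/2 else 0) - \<epsilon> * v_field (axis k 1) $ j + \<gamma> $ j * \<phi> $ k))"
      by (intro sum.cong refl arg_cong2[where f = times])
    also have "\<dots> = X i p y $ k / 2 - \<epsilon> * (X i p y \<bullet> v_field (axis k 1)) + (X i p y \<bullet> \<gamma>) * \<phi> $ k"
      using exhaust_2[of k] by (auto simp: sum_2 inner_vec_def algebra_simps)
    also have "X i p y \<bullet> v_field (axis k 1) = - (v_field (X i p y) $ k)"
      by (rule inner_v_field_axis)
    also have "v_field (X i p y) $ k
        = v_field (axis i 1) $ k / 2 - \<epsilon> * (if i = k then 1 else 0) + \<gamma> $ i * v_field \<phi> $ k"
      by (simp add: X_def \<gamma>_def \<phi>_def v_field_add v_field_scaleR v_field_v_field axis_def)
    also have "X i p y \<bullet> \<gamma> = \<gamma> $ i - \<epsilon> * v_field \<gamma> $ i"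
      unfolding X_def \<gamma>_def inner_add_left inner_scaleR_left
        phi_gamma[unfolded \<gamma>_def \<phi>_def] inner_axis_1 inner_v_field_axis by simp
    finally show ?thesis by (simp add: algebra_simps)
  qed
  have Jgamma: "v_field \<gamma> = (1/2) *\<^sub>R v_field \<mu> + \<epsilon> *\<^sub>R \<nu>"
    by (simp add: \<gamma> v_field_diff v_field_scaleR v_field_v_field)
  \<comment> \<open>\<open>A\<close> and \<open>B\<close> are the x- and y-gradients of the first
    y-derivatives of the spray.\<close>
  define A where "A = X i p y $ k *\<^sub>R (\<Phi> *\<^sub>R cotwist \<phi>)
    + \<Phi> *\<^sub>R (\<gamma> $ i *\<^sub>R cotwist (gt p y k) + \<phi> $ k *\<^sub>R cotwist w)"
  define B where "B = X i p y $ k *\<^sub>R \<phi> + (\<gamma> $ i * v_field \<mu> $ k * k3) *\<^sub>R v_field \<mu>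
    + \<phi> $ k *\<^sub>R ((1/2) *\<^sub>R axis i 1 + w)"
  have AB: "has_grads (partial_y k (geodesic_coeff F i)) A B p y"
    using has_grads_partial_y_geodesic_coeff[OF W, of k i]
    by (simp add: A_def B_def \<phi>_def \<mu>_def \<Phi>_def \<gamma>_def k3_def w_def add.assoc)
  \<comment> \<open>The two middle terms of the curvature formula, sorted by the product rule
    according to which factor of F (... + c_i f_k) is differentiated.\<close>
  have "- (y \<bullet> A) + (\<Phi>\<^sup>2 *\<^sub>R s) \<bullet> B
      = \<Phi>\<^sup>2 * (X i p y $ k * (- (\<mu> \<bullet> cotwist \<phi>) + s \<bullet> \<phi>)
        + \<gamma> $ i * (- (\<mu> \<bullet> cotwist (gt p y k)) + s \<bullet> ((v_field \<mu> $ k * k3) *\<^sub>R v_field \<mu>))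
        + \<phi> $ k * (- (\<mu> \<bullet> cotwist w) + s \<bullet> ((1/2) *\<^sub>R axis i 1 + w)))"
    unfolding A_def B_def by (subst y) (simp add: inner_add_right power2_eq_square algebra_simps)
  note spray = this[unfolded d_F d_c d_f]
  have axis_nth': "axis i 1 $ k = (if i = k then 1 else 0 :: real)" by (simp add: axis_def)
  have "riemann_curvature F i k p y = 2 * (\<Phi>\<^sup>2 * cotwist (\<gamma> $ i *\<^sub>R \<phi> + (\<epsilon> / 2) *\<^sub>R v_field (axis i 1)) $ k)
      + (- (y \<bullet> A) + (\<Phi>\<^sup>2 *\<^sub>R s) \<bullet> B) - \<Phi>\<^sup>2 * (\<Sum>j\<in>UNIV. X i p y $ j * X j p y $ k)"
  proof -
    have "2 * (\<Sum>j\<in>UNIV. geodesic_coeff F j p y * B $ j) = (\<Sum>j\<in>UNIV. (2 * geodesic_coeff F j p y) * B $ j)"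
      by (simp add: sum_distrib_left mult.assoc)
    also have "\<dots> = (\<Phi>\<^sup>2 *\<^sub>R s) \<bullet> B" unfolding G by (simp add: inner_vec_def)
    finally have *: "2 * (\<Sum>j\<in>UNIV. geodesic_coeff F j p y * B $ j) = (\<Phi>\<^sup>2 *\<^sub>R s) \<bullet> B" .
    show ?thesis
      unfolding riemann_curvature_def partial_x_eq[OF AB] partial_y_eq[OF AB] * inner_sum_2
        partial_x_eq[OF has_grads_geodesic_coeff[OF W]] partial_y_eq[OF has_grads_geodesic_coeff[OF W]]
      by (simp add: \<Phi>_def \<gamma>_def \<phi>_def power2_eq_square sum_distrib_left mult_ac)
  qed
  also have "\<dots> = - 1/4 * (\<Phi>\<^sup>2 * (if i = k then 1 else 0) - \<Phi> * \<phi> $ k * (\<Phi> * \<mu> $ i))"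
    unfolding spray X_square
    unfolding Jgamma Xik cotwist_def v_field_add v_field_scaleR v_field_v_field
      vector_add_component vector_scaleR_component vector_uminus_component real_scaleR_def
    by (simp add: \<gamma> axis_nth' power2_eq_square field_simps)
  finally show "riemann_curvature F i k p y =
    - 1/4 * ((F p y)\<^sup>2 * (if i = k then 1 else 0) - F p y * partial_y k F p y * y $ i)"
    by (simp add: partial_y_eq[OF has_grads_F[OF W]] y[symmetric] \<Phi>_def \<phi>_def)
      (metis y vector_scaleR_component real_scaleR_def \<Phi>_def)
qed

section \<open>S-curvature and the Randers decomposition\<close>

lemma indicatrix_ball:
  assumes p: "p \<in> disk \<rho>"
  shows "{y. F p y < 1} = ball (- q p) 1"
proof -
  have D: "D p > 0" using p disk_iff by simp
  have "F p y < 1 \<longleftrightarrow> (y + q p) \<bullet> (y + q p) < 1" for y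
  proof -
    have "F p y < 1 \<longleftrightarrow> T p y < D p - q p \<bullet> y" using D by (auto simp: F_eq'[OF p] divide_less_eq)
    also have "\<dots> \<longleftrightarrow> D p - q p \<bullet> y > 0 \<and> (T p y)\<^sup>2 < (D p - q p \<bullet> y)\<^sup>2"
    proof -
      have "T p y \<ge> 0" using D by (simp add: T_def)
      thus ?thesis by (smt (verit) power2_less_imp_less power_strict_mono zero_less_numeral)
    qed
    also have "(T p y)\<^sup>2 < (D p - q p \<bullet> y)\<^sup>2 \<longleftrightarrow> D p * (y \<bullet> y) < D p * (D p - 2 * (q p \<bullet> y))"
      using T_square[OF p, of y] by (simp add: power2_eq_square algebra_simps)
    also have "\<dots> \<longleftrightarrow> y \<bullet> y < D p - 2 * (q p \<bullet> y)" using D by simp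
    \<comment> \<open>The second inequality gives 2 <q, y> < D, and with D > 0 the sign condition
      follows.\<close>
    also have "D p - q p \<bullet> y > 0 \<and> y \<bullet> y < D p - 2 * (q p \<bullet> y) \<longleftrightarrow> y \<bullet> y < D p - 2 * (q p \<bullet> y)"
      using D inner_ge_zero[of y] by (smt (verit))
    also have "\<dots> \<longleftrightarrow> (y + q p) \<bullet> (y + q p) < 1"
      by (auto simp: D_def inner_add_left inner_add_right inner_commute algebra_simps)
    finally show ?thesis .
  qed
  moreover have "dist (- q p) y < 1 \<longleftrightarrow> (y + q p) \<bullet> (y + q p) < 1" for y
  proof -
    have "dist (- q p) y = norm (y + q p)" by (simp add: dist_norm norm_minus_commute)
    thus ?thesis by (simp add: norm_eq_sqrt_inner)
  qed
  ultimately show ?thesis by (auto simp: mem_ball)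
qed

lemma BH_density_eq:
  assumes "p \<in> disk \<rho>"
  shows "BH_density F p = 1"
proof -
  have "measure lebesgue (ball (- q p) 1) = measure lebesgue ((+) (- q p) ` ball 0 1)"
    by (simp only: image_add_ball) simp
  also have "\<dots> = measure lebesgue (ball (0::real^2) 1)" by (rule measure_translation)
  finally have "measure lebesgue (ball (- q p) 1) = measure lebesgue (ball (0::real^2) 1)" .
  moreover have "measure lebesgue (ball (0::real^2) 1) > 0"
    using content_ball_pos[of 1 "0::real^2"] by (simp add: measure_completion)
  ultimately show ?thesis by (simp add: BH_density_def indicatrix_ball[OF assms])
qed

text \<open>The density is constant, so only the divergence of the spray remains, F times the trace
  of X: half the identity contributes 1, J is traceless, and <c, f> = 1/2.\<close>

theorem S_curvature_eq:
  assumes W: "(p, y) \<in> W"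
  shows "S_curvature F p y = 3/2 * F p y"
proof -
  have p: "p \<in> disk \<rho>" using W by (simp add: W_def)
  have "((\<lambda>p. 1 :: real) has_derivative (\<lambda>h. 0)) (at p)" by simp
  hence "(BH_density F has_derivative (\<lambda>h. 0)) (at p)"
    by (rule has_derivative_transform_within_open[OF _ open_disk p]) (simp add: BH_density_eq)
  hence BH: "partial i (BH_density F) p = 0" for i by (rule partialI) simp
  have "c p y \<bullet> f p y = 1/2"
    unfolding c_def inner_diff_left inner_scaleR_left inner_commute[of "m p y"] f_inner_m[OF W]
    by (simp add: f_def inner_v_field_self)
  hence "(\<Sum>i\<in>UNIV. c p y $ i * f p y $ i) = 1/2" by (simp add: inner_vec_def)
  moreover have "partial_y i (geodesic_coeff F i) p y = F p y * (1/2 + c p y $ i * f p y $ i)" for i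
    using exhaust_2[of i]
    by (auto simp: partial_y_eq[OF has_grads_geodesic_coeff[OF W]] X_def axis_def v_field_component)
  ultimately show ?thesis
    by (simp add: S_curvature_def BH sum_distrib_left[symmetric] sum.distrib)
qed

text \<open>The matrix of the Klein metric at the point q p, evaluated on the untwisted vector y.
  For \<open>\<epsilon>\<close> \<noteq> 0 this is not the pullback of the Klein metric under
  \<open>q\<close>, which leaves room for variable curvature.\<close>

definition a :: "real^2 \<Rightarrow> real^2^2" where
  "a p = (\<chi> i j. ((if i = j then D p else 0) + q p $ i * q p $ j) / (D p)\<^sup>2)"

definition b :: "real^2 \<Rightarrow> real^2" where "b p = (1 / D p) *\<^sub>R q p"

lemma inner_a: "y \<bullet> (a p *v y) = ((q p \<bullet> y)\<^sup>2 + D p * (y \<bullet> y)) / (D p)\<^sup>2"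
  by (simp add: a_def matrix_vector_mult_def inner_vec_def sum_2 divide_inverse power2_eq_square algebra_simps)

lemma sqrt_inner_a: "p \<in> disk \<rho> \<Longrightarrow> sqrt (y \<bullet> (a p *v y)) = T p y / D p"
  using disk_iff[of p] by (simp add: inner_a T_def real_sqrt_divide)

text \<open>A supremum below 1 requires a bound uniform in y; Cauchy-Schwarz provides |q|.\<close>

lemma sup_less_1:
  assumes p: "p \<in> disk \<rho>"
  shows "(SUP y\<in>UNIV - {0}. (b p \<bullet> y) / sqrt (y \<bullet> (a p *v y))) < 1"
proof -
  have D: "D p > 0" using p disk_iff by simp
  have "(SUP y\<in>UNIV - {0}. (b p \<bullet> y) / sqrt (y \<bullet> (a p *v y))) \<le> norm (q p)"
  proof (rule cSUP_least)
    have "axis 1 1 \<in> UNIV - {0::real^2}" by (simp add: axis_eq_0_iff)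
    thus "UNIV - {0::real^2} \<noteq> {}" by (metis empty_iff)
  next
    fix y :: "real^2" assume "y \<in> UNIV - {0}"
    hence W: "(p, y) \<in> W" using p by (simp add: W_def)
    \<comment> \<open>Cauchy-Schwarz times D = 1 - |q|^2 rearranges to <q, y>^2 \<le> |q|^2
      T^2.\<close>
    have "D p * (q p \<bullet> y)\<^sup>2 \<le> D p * ((q p \<bullet> q p) * (y \<bullet> y))"
      by (rule mult_left_mono[OF Cauchy_Schwarz_ineq less_imp_le[OF D]])
    moreover have "(1 - Q) * B \<le> (1 - Q) * (Q * A) \<Longrightarrow> B \<le> Q * (B + (1 - Q) * A)" for A B Q :: real
      by (simp add: algebra_simps)
    ultimately have "(q p \<bullet> y)\<^sup>2 \<le> (q p \<bullet> q p) * ((q p \<bullet> y)\<^sup>2 + D p * (y \<bullet> y))"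
      unfolding D_def by blast
    also have "\<dots> = (norm (q p) * T p y)\<^sup>2"
      unfolding power_mult_distrib power2_norm_eq_inner using T_square[OF p, of y]
      by (simp add: power2_eq_square)
    finally have "q p \<bullet> y \<le> norm (q p) * T p y"
      by (rule power2_le_imp_le) (simp add: T_pos[OF W] less_imp_le)
    moreover have "(b p \<bullet> y) / sqrt (y \<bullet> (a p *v y)) = (q p \<bullet> y) / T p y"
      unfolding sqrt_inner_a[OF p] using D by (simp add: b_def)
    ultimately show "(b p \<bullet> y) / sqrt (y \<bullet> (a p *v y)) \<le> norm (q p)"
      using T_pos[OF W] by (simp add: divide_le_eq)
  qed
  also have "norm (q p) < 1" using D by (simp add: D_def norm_eq_sqrt_inner)
  finally show ?thesis .
qed

lemma q_component: "q p $ 1 = p $ 1 + \<epsilon> * p $ 2" "q p $ 2 = p $ 2 - \<epsilon> * p $ 1"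
  by (simp_all add: twist_def v_field_component)

section \<open>Smoothness of the Randers data\<close>

lemma smooth_on_fst_component: "open S \<Longrightarrow> smooth_on S (\<lambda>z :: (real^2) \<times> (real^2). fst z $ i)"
  and smooth_on_snd_component: "open S \<Longrightarrow> smooth_on S (\<lambda>z :: (real^2) \<times> (real^2). snd z $ i)"
  and smooth_on_component: "open S' \<Longrightarrow> smooth_on S' (\<lambda>p :: real^2. p $ i)"
  by (auto intro!: smooth_on_bounded_linear bounded_linear_compose[OF bounded_linear_vec_nth]
      bounded_linear_fst bounded_linear_snd bounded_linear_ident)

lemmas smooth_intros = smooth_on_const smooth_on_add smooth_on_diff smooth_on_mult smooth_on_divide
  smooth_on_sqrt smooth_on_fst_component smooth_on_snd_component smooth_on_component

lemma smooth_on_F: "smooth_on W (\<lambda>(p, y). F p y)"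
proof -
  have q: "smooth_on W (\<lambda>z. q (fst z) $ i)" for i
    using exhaust_2[of i] by (auto simp: q_component intro!: smooth_intros open_W)
  have qy: "smooth_on W (\<lambda>z. q (fst z) \<bullet> snd z)"
    unfolding inner_vec_def sum_2 inner_real_def by (intro smooth_intros q open_W)
  have yy: "smooth_on W (\<lambda>z. snd z \<bullet> snd z)"
    unfolding inner_vec_def sum_2 inner_real_def by (intro smooth_intros open_W)
  have D: "smooth_on W (\<lambda>z. D (fst z))"
    unfolding inner_vec_def sum_2 inner_real_def D_def by (intro smooth_intros q open_W)
  have T: "smooth_on W (\<lambda>z. T (fst z) (snd z))"
    unfolding T_def power2_eq_square
    by (rule smooth_on_sqrt[OF open_W _ smooth_on_add[OF open_W smooth_on_mult[OF open_W qy qy]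
            smooth_on_mult[OF open_W D yy]]])
       (use radicand_pos in \<open>auto simp: power2_eq_square\<close>)
  have "smooth_on W (\<lambda>z. (q (fst z) \<bullet> snd z + T (fst z) (snd z)) / D (fst z))"
    by (rule smooth_on_divide[OF open_W smooth_on_add[OF open_W qy T] D])
       (auto simp: W_def disk_iff)
  thus ?thesis
    by (subst smooth_on_cong[OF open_W]) (auto simp: W_def F_eq')
qed

lemma smooth_on_a: "smooth_on (disk \<rho>) a"
proof (rule smooth_on_Basis[OF open_disk])
  fix B :: "real^2^2" assume "B \<in> Basis"
  then obtain i j where B: "B = axis i (axis j 1)" by (auto simp: Basis_vec_def)
  have eq: "a p \<bullet> B = ((if i = j then 1 else 0) * D p + q p $ i * q p $ j) / (D p * D p)" for p
    by (simp add: B a_def inner_axis power2_eq_square)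
  have q: "smooth_on (disk \<rho>) (\<lambda>p. q p $ i)" for i
    using exhaust_2[of i] by (auto simp: q_component intro!: smooth_intros open_disk)
  have D: "smooth_on (disk \<rho>) D"
    unfolding D_def inner_vec_def sum_2 inner_real_def by (intro smooth_intros q open_disk)
  show "smooth_on (disk \<rho>) (\<lambda>p. a p \<bullet> B)"
    unfolding eq by (intro smooth_intros q D open_disk) (auto simp: disk_iff)
qed

lemma smooth_on_b: "smooth_on (disk \<rho>) b"
proof (rule smooth_on_Basis[OF open_disk])
  fix B :: "real^2" assume "B \<in> Basis"
  then obtain i where B: "B = axis i 1" by (auto simp: Basis_vec_def)
  have eq: "b p \<bullet> B = q p $ i / D p" for p
    by (simp add: B b_def inner_axis)
  have q: "smooth_on (disk \<rho>) (\<lambda>p. q p $ i)" for i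
    using exhaust_2[of i] by (auto simp: q_component intro!: smooth_intros open_disk)
  have D: "smooth_on (disk \<rho>) D"
    unfolding D_def inner_vec_def sum_2 inner_real_def by (intro smooth_intros q open_disk)
  show "smooth_on (disk \<rho>) (\<lambda>p. b p \<bullet> B)"
    unfolding eq by (intro smooth_intros q D open_disk) (auto simp: disk_iff)
qed

lemma F_homogeneous:
  assumes p: "p \<in> disk \<rho>" and r: "r > 0"
  shows "F p (r *\<^sub>R y) = r * F p y"
proof -
  have "T p (r *\<^sub>R y) = r * T p y"
  proof -
    have "(q p \<bullet> r *\<^sub>R y)\<^sup>2 + D p * (r *\<^sub>R y \<bullet> r *\<^sub>R y) = r\<^sup>2 * ((q p \<bullet> y)\<^sup>2 + D p * (y \<bullet> y))"
      by (simp add: power2_eq_square algebra_simps)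
    thus ?thesis using r by (simp add: T_def real_sqrt_mult)
  qed
  thus ?thesis by (simp add: F_eq'[OF p] add_divide_distrib algebra_simps)
qed

theorem randers_metric: "randers_metric_on (disk \<rho>) F a b"
proof -
  have F0: "0 \<le> F p y" if "p \<in> disk \<rho>" for p y
    using F_pos[of p y] that by (cases "y = 0") (auto simp: W_def F_eq' T_def)
  have a: "pos_def_matrix (a p)" if p: "p \<in> disk \<rho>" for p
  proof -
    have "transpose (a p) = a p"
      by (auto simp: vec_eq_iff transpose_def a_def mult.commute)
    moreover have "0 < z \<bullet> (a p *v z)" if "z \<noteq> 0" for z
      using radicand_pos[of p z] p that disk_iff[of p] by (simp add: inner_a W_def)
    ultimately show ?thesis by (simp add: pos_def_matrix_def)
  qed
  have "F p y = sqrt (y \<bullet> (a p *v y)) + b p \<bullet> y" if p: "p \<in> disk \<rho>" for p y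
    by (simp add: sqrt_inner_a[OF p] F_eq'[OF p] b_def add_divide_distrib)
  thus ?thesis
    unfolding randers_metric_on_def finsler_metric_on_def
    using F0 smooth_on_F smooth_on_a smooth_on_b a sup_less_1 F_homogeneous fundamental_tensor_pos_def
    by (auto simp: W_def)
qed

section \<open>Gauss curvature of the Riemannian part\<close>

lemma D_q: "D p = 1 - q p $ 1 * q p $ 1 - q p $ 2 * q p $ 2"
  by (simp add: D_def inner_vec_def sum_2)

lemma partial_a:
  assumes p: "p \<in> disk \<rho>"
  shows "partial k (\<lambda>p. a p $ i $ j) p = cotwist ((if i = j then 2 / (D p)\<^sup>2 else 0) *\<^sub>R q p
    + (q p $ i / (D p)\<^sup>2) *\<^sub>R axis j 1 + (q p $ j / (D p)\<^sup>2) *\<^sub>R axis i 1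
    + (4 * q p $ i * q p $ j / (D p)^3) *\<^sub>R q p) $ k"
proof (rule partial_eq)
  have "has_grads (\<lambda>p y. ((if i = j then 1 else 0) * D p + q p $ i * q p $ j) / (D p * D p))
   (cotwist ((if i = j then 2 / (D p)\<^sup>2 else 0) *\<^sub>R q p
    + (q p $ i / (D p)\<^sup>2) *\<^sub>R axis j 1 + (q p $ j / (D p)\<^sup>2) *\<^sub>R axis i 1
    + (4 * q p $ i * q p $ j / (D p)^3) *\<^sub>R q p)) 0 p 0"
    using p disk_iff[of p]
    by (intro has_grads_eqI[OF has_grads_divide[OF has_grads_add[OF has_grads_mult[OF has_grads_const has_grads_D]
        has_grads_mult[OF has_grads_q has_grads_q]] has_grads_mult[OF has_grads_D has_grads_D]]])
       (simp_all add: vec_eq_iff cotwist_add cotwist_scaleR field_simps power2_eq_square power3_eq_cube)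
  moreover have "((if i = j then 1 else 0) * D p + q p $ i * q p $ j) / (D p * D p) = a p $ i $ j" for p
    by (simp add: a_def power2_eq_square)
  ultimately show "has_grads (\<lambda>p y. a p $ i $ j)
   (cotwist ((if i = j then 2 / (D p)\<^sup>2 else 0) *\<^sub>R q p
    + (q p $ i / (D p)\<^sup>2) *\<^sub>R axis j 1 + (q p $ j / (D p)\<^sup>2) *\<^sub>R axis i 1
    + (4 * q p $ i * q p $ j / (D p)^3) *\<^sub>R q p)) 0 p 0" by simp
qed

text \<open>The product (D I + q q^T) (I - q q^T) is D I, because |q|^2 = 1 - D cancels the rank-one
  terms.\<close>

lemma matrix_inv_a:
  assumes p: "p \<in> disk \<rho>"
  shows "matrix_inv (a p) = (\<chi> i j. D p * ((if i = j then 1 else 0) - q p $ i * q p $ j))"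
proof (rule matrix_inv_eqI)
  have D: "D p > 0" using p disk_iff by simp
  define Q1 where "Q1 = q p $ 1"
  define Q2 where "Q2 = q p $ 2"
  \<comment> \<open>A nonzero atom for clearing denominators; its expression in the coordinates of q
    is substituted only afterwards.\<close>
  define d where "d = D p"
  have d: "d \<noteq> 0" "d = 1 - Q1 * Q1 - Q2 * Q2" using D D_q by (simp_all add: d_def Q1_def Q2_def)
  show "a p ** (\<chi> i j. D p * ((if i = j then 1 else 0) - q p $ i * q p $ j)) = mat 1"
    unfolding vec_eq_iff forall_2 a_def matrix_matrix_mult_def mat_def
    apply (simp add: sum_2 Q1_def[symmetric] Q2_def[symmetric] d_def[symmetric] power2_eq_square d(1) field_simps)
    apply (simp add: d(2) algebra_simps)
    done
qed

text \<open>The coefficients of \<open>1 / D\<close> and \<open>1 / D\<^sup>2\<close> in the Christoffel symbols.\<close>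

definition chr1_vec :: "2 \<Rightarrow> 2 \<Rightarrow> 2 \<Rightarrow> real^2" where
  "chr1_vec i j k = (if i = 1 then
       (if j = 1 \<and> k = 1 then vector [2, - \<epsilon>]
        else if j = 2 \<and> k = 2 then vector [0, 3 * \<epsilon>] else vector [2 * \<epsilon>, 1])
     else
       (if j = 1 \<and> k = 1 then vector [- 3 * \<epsilon>, 0]
        else if j = 2 \<and> k = 2 then vector [\<epsilon>, 2] else vector [1, - 2 * \<epsilon>]))"

definition chr1 :: "2 \<Rightarrow> 2 \<Rightarrow> 2 \<Rightarrow> real^2 \<Rightarrow> real" where
  "chr1 i j k p = chr1_vec i j k \<bullet> q p"

definition chr2 :: "2 \<Rightarrow> 2 \<Rightarrow> 2 \<Rightarrow> real^2 \<Rightarrow> real" where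
  "chr2 i j k p = - 2 * \<epsilon> * (v_field (q p) $ i * q p $ j * q p $ k)"

text \<open>For \<open>\<epsilon>\<close> = 0 the right-hand side is (\<delta>_ij q_k + \<delta>_ik
  q_j) / D, the symbols of the Klein metric. The remaining terms stem from the derivative of q; all
  index triples are checked.\<close>

lemma christoffel_a:
  assumes p: "p \<in> disk \<rho>"
  shows "christoffel a i j k p = chr1 i j k p / D p + chr2 i j k p / (D p * D p)"
proof -
  have D: "D p > 0" using p disk_iff by simp
  define Q1 where "Q1 = q p $ 1"
  define Q2 where "Q2 = q p $ 2"
  define d where "d = D p"
  have d: "d \<noteq> 0" "d = 1 - Q1 * Q1 - Q2 * Q2" using D D_q by (simp_all add: d_def Q1_def Q2_def)
  \<comment> \<open>The partial derivatives of the metric multiplied by D^3.\<close>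
  define A where "A k i j = cotwist ((if i = j then 2 * d else 0) *\<^sub>R q p + (d * q p $ i) *\<^sub>R axis j 1
      + (d * q p $ j) *\<^sub>R axis i 1 + (4 * q p $ i * q p $ j) *\<^sub>R q p) $ k" for i j k
  have P: "partial k (\<lambda>p. a p $ i $ j) p = A k i j / d ^ 3" for i j k
    unfolding partial_a[OF p] A_def cotwist_add cotwist_scaleR using d(1)
    by (simp add: d_def[symmetric] power2_eq_square power3_eq_cube add_divide_distrib)
  have "christoffel a i j k p
    = (\<Sum>l\<in>UNIV. ((if i = l then 1 else 0) - q p $ i * q p $ l) * (A j l k + A k l j - A l j k)) / (2 * (d * d))"
    unfolding christoffel_def P matrix_inv_a[OF p] using d(1)
    by (simp add: sum_2 d_def[symmetric] power3_eq_cube add_divide_distrib[symmetric] diff_divide_distrib[symmetric]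
       mult.assoc distrib_left[symmetric])
  also have "(\<Sum>l\<in>UNIV. ((if i = l then 1 else 0) - q p $ i * q p $ l) * (A j l k + A k l j - A l j k))
      = 2 * (chr1 i j k p * d + chr2 i j k p)"
  proof -
    have "i = 1 \<or> i = 2" "j = 1 \<or> j = 2" "k = 1 \<or> k = 2" by (rule exhaust_2)+
    thus ?thesis
      by (auto simp: sum_2 A_def chr1_def chr1_vec_def inner_vec_def chr2_def cotwist_def v_field_component axis_def
        Q1_def[symmetric] Q2_def[symmetric] d(2) algebra_simps)
  qed
  finally show ?thesis using d(1) by (simp add: d_def[symmetric] add_divide_distrib)
qed

lemma partial_christoffel:
  assumes p: "p \<in> disk \<rho>"
  shows "partial l (christoffel a i j k) p = cotwist (((D p)\<^sup>2) *\<^sub>R chr1_vec i j k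
    + (2 * D p * chr1 i j k p + 4 * chr2 i j k p) *\<^sub>R q p
    - (2 * \<epsilon> * D p) *\<^sub>R ((v_field (q p) $ i * q p $ k) *\<^sub>R axis j 1 + (v_field (q p) $ i * q p $ j) *\<^sub>R axis k 1
        - (q p $ j * q p $ k) *\<^sub>R v_field (axis i 1))) $ l / (D p)^3"
proof -
  have D: "D p > 0" using p disk_iff by simp
  have 1: "has_grads (\<lambda>p y. chr1 i j k p) (cotwist (chr1_vec i j k)) 0 p 0"
    unfolding chr1_def inner_vec_def sum_2 inner_real_def
    by (intro has_grads_eqI[OF has_grads_add[OF has_grads_mult[OF has_grads_const has_grads_q]
            has_grads_mult[OF has_grads_const has_grads_q]]])
       (simp_all add: vec_eq_iff forall_2 cotwist_def v_field_component axis_def)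
  have 2: "has_grads (\<lambda>p y. chr2 i j k p) (cotwist ((- 2 * \<epsilon>) *\<^sub>R
      ((v_field (q p) $ i * q p $ k) *\<^sub>R axis j 1 + (v_field (q p) $ i * q p $ j) *\<^sub>R axis k 1
        - (q p $ j * q p $ k) *\<^sub>R v_field (axis i 1)))) 0 p 0"
    unfolding chr2_def
    by (intro has_grads_eqI[OF has_grads_mult[OF has_grads_const has_grads_mult[OF
            has_grads_mult[OF has_grads_Jq has_grads_q] has_grads_q]]])
       (simp_all add: vec_eq_iff cotwist_add cotwist_diff cotwist_scaleR algebra_simps)
  have "has_grads (\<lambda>p y. chr1 i j k p / D p + chr2 i j k p / (D p * D p)) (cotwist ((1 / (D p)^3) *\<^sub>R (((D p)\<^sup>2) *\<^sub>R chr1_vec i j k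
    + (2 * D p * chr1 i j k p + 4 * chr2 i j k p) *\<^sub>R q p
    - (2 * \<epsilon> * D p) *\<^sub>R ((v_field (q p) $ i * q p $ k) *\<^sub>R axis j 1 + (v_field (q p) $ i * q p $ j) *\<^sub>R axis k 1
        - (q p $ j * q p $ k) *\<^sub>R v_field (axis i 1))))) 0 p 0"
    using D
    by (intro has_grads_eqI[OF has_grads_add[OF has_grads_divide[OF 1 has_grads_D]
            has_grads_divide[OF 2 has_grads_mult[OF has_grads_D has_grads_D]]]];
        (simp only: vec_eq_iff cotwist_add cotwist_diff cotwist_scaleR)?)
       (simp_all add: power2_eq_square power3_eq_cube, simp_all add: field_simps)
  from has_grads_fst_derivative[OF this]
  have "((\<lambda>p. chr1 i j k p / D p + chr2 i j k p / (D p * D p)) has_derivative (\<lambda>h. cotwist ((1 / (D p)^3) *\<^sub>R (((D p)\<^sup>2) *\<^sub>R chr1_vec i j k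
    + (2 * D p * chr1 i j k p + 4 * chr2 i j k p) *\<^sub>R q p
    - (2 * \<epsilon> * D p) *\<^sub>R ((v_field (q p) $ i * q p $ k) *\<^sub>R axis j 1 + (v_field (q p) $ i * q p $ j) *\<^sub>R axis k 1
        - (q p $ j * q p $ k) *\<^sub>R v_field (axis i 1)))) \<bullet> h)) (at p)" .
  hence "(christoffel a i j k has_derivative (\<lambda>h. cotwist ((1 / (D p)^3) *\<^sub>R (((D p)\<^sup>2) *\<^sub>R chr1_vec i j k
    + (2 * D p * chr1 i j k p + 4 * chr2 i j k p) *\<^sub>R q p
    - (2 * \<epsilon> * D p) *\<^sub>R ((v_field (q p) $ i * q p $ k) *\<^sub>R axis j 1 + (v_field (q p) $ i * q p $ j) *\<^sub>R axis k 1
        - (q p $ j * q p $ k) *\<^sub>R v_field (axis i 1)))) \<bullet> h)) (at p)"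
    by (rule has_derivative_transform_within_open[OF _ open_disk p]) (simp add: christoffel_a)
  thus ?thesis
    by (rule partialI) (simp only: inner_axis_1 cotwist_scaleR, simp)
qed

text \<open>In dimension two the components must be K a_22 for l = 1 and - K a_12 for l = 2. The
  proof verifies both with one K; contracting with the first row of a then gives K det a.\<close>

theorem gauss_curvature_a:
  assumes p: "p \<in> disk \<rho>"
  shows "gauss_curvature a p = \<epsilon>\<^sup>2 - 1 - 6 * \<epsilon>\<^sup>2 / D p"
proof -
  have D: "D p > 0" using p disk_iff by simp
  define Q1 where "Q1 = q p $ 1"
  define Q2 where "Q2 = q p $ 2"
  define d where "d = D p"
  have d: "d \<noteq> 0" "d = 1 - Q1 * Q1 - Q2 * Q2" using D D_q by (simp_all add: d_def Q1_def Q2_def)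
  define K where "K = ((\<epsilon>\<^sup>2 - 1) * d - 6 * \<epsilon>\<^sup>2) / d"
  define dG where "dG l i j k = cotwist ((d\<^sup>2) *\<^sub>R chr1_vec i j k
    + (2 * d * chr1 i j k p + 4 * chr2 i j k p) *\<^sub>R q p
    - (2 * \<epsilon> * d) *\<^sub>R ((v_field (q p) $ i * q p $ k) *\<^sub>R axis j 1 + (v_field (q p) $ i * q p $ j) *\<^sub>R axis k 1
        - (q p $ j * q p $ k) *\<^sub>R v_field (axis i 1))) $ l" for l i j k
  define C where "C i j k = chr1 i j k p * d + chr2 i j k p" for i j k
  have G: "christoffel a i j k p = C i j k / (d * d)" for i j k
    using d(1) by (simp add: christoffel_a[OF p] C_def d_def[symmetric] add_divide_distrib)
  \<comment> \<open>The derivatives carry D^3 and the products of symbols D^4 in the denominator;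
    clearing D^4 makes the numerators polynomial.\<close>
  have R: "riemann_tensor a l 2 1 2 p * (d * (d * (d * d))) = d * (dG 1 l 2 2 - dG 2 l 1 2)
     + (\<Sum>m\<in>UNIV. C l 1 m * C m 2 2 - C l 2 m * C m 1 2)" for l
    unfolding riemann_tensor_def partial_christoffel[OF p] G d_def[symmetric] dG_def[symmetric]
    using d(1) by (simp add: sum_2 power3_eq_cube field_simps)
  note simps = dG_def C_def chr1_def chr1_vec_def inner_vec_def chr2_def cotwist_def v_field_component axis_def
        sum_2 Q1_def[symmetric] Q2_def[symmetric]
  have N1: "d * (dG 1 1 2 2 - dG 2 1 1 2) + (\<Sum>m\<in>UNIV. C 1 1 m * C m 2 2 - C 1 2 m * C m 1 2)
     = d * (((\<epsilon>\<^sup>2 - 1) * d - 6 * \<epsilon>\<^sup>2) * (d + Q2 * Q2))"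
    by (simp add: simps) (simp add: d(2) power2_eq_square algebra_simps)
  have R1: "riemann_tensor a 1 2 1 2 p = K * ((d + Q2 * Q2) / d\<^sup>2)"
    using R[of 1, unfolded N1] d(1) by (simp add: K_def eq_divide_eq power2_eq_square mult_ac)
  have N2: "d * (dG 1 2 2 2 - dG 2 2 1 2) + (\<Sum>m\<in>UNIV. C 2 1 m * C m 2 2 - C 2 2 m * C m 1 2)
     = d * ((6 * \<epsilon>\<^sup>2 - (\<epsilon>\<^sup>2 - 1) * d) * (Q1 * Q2))"
    by (simp add: simps) (simp add: d(2) power2_eq_square algebra_simps)
  have "riemann_tensor a 2 2 1 2 p = (6 * \<epsilon>\<^sup>2 - (\<epsilon>\<^sup>2 - 1) * d) / d * (Q1 * Q2 / d\<^sup>2)"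
    using R[of 2, unfolded N2] d(1) by (simp add: eq_divide_eq power2_eq_square mult_ac)
  also have "(6 * \<epsilon>\<^sup>2 - (\<epsilon>\<^sup>2 - 1) * d) / d = - K" by (simp add: K_def diff_divide_distrib)
  finally have R2: "riemann_tensor a 2 2 1 2 p = - K * (Q1 * Q2 / d\<^sup>2)" .
  have a: "a p $ 1 $ 1 = (d + Q1 * Q1) / d\<^sup>2" "a p $ 1 $ 2 = Q1 * Q2 / d\<^sup>2"
    "a p $ 2 $ 1 = Q1 * Q2 / d\<^sup>2" "a p $ 2 $ 2 = (d + Q2 * Q2) / d\<^sup>2"
    by (simp_all add: a_def d_def Q1_def Q2_def)
  have "det (a p) = ((d + Q1 * Q1) * (d + Q2 * Q2) - (Q1 * Q2) * (Q1 * Q2)) / (d\<^sup>2 * d\<^sup>2)"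
    unfolding det_2 a by (simp add: diff_divide_distrib)
  also have "(d + Q1 * Q1) * (d + Q2 * Q2) - (Q1 * Q2) * (Q1 * Q2) = d"
    by (simp add: d(2) algebra_simps)
  finally have "det (a p) > 0" using D by (simp add: d_def)
  have "gauss_curvature a p = K * det (a p) / det (a p)"
    unfolding gauss_curvature_def sum_2 R1 R2 det_2 a by (simp add: algebra_simps)
  thus ?thesis using \<open>det (a p) > 0\<close> d(1) by (simp add: K_def d_def[symmetric] diff_divide_distrib)
qed

section \<open>Projective flatness\<close>

lemma zero_in_disk: "0 \<in> disk \<rho>"
  by (simp add: disk_iff D_def twist_def v_field_def vec_eq_iff forall_2 inner_vec_def sum_2)

lemma q_zero: "q 0 = 0"
  by (simp add: vec_eq_iff forall_2 q_component)

lemma gt_zero: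
  assumes "y \<noteq> 0"
  shows "gt 0 y i $ j = (if i = j then 1 else 0)"
proof -
  have W: "(0, y) \<in> W" using assms zero_in_disk by (simp add: W_def)
  have n: "n 0 y = m 0 y" by (simp add: n_def q_zero)
  hence k: "\<kappa> 0 y = 1" and mm: "m 0 y \<bullet> m 0 y = 1" using n_unit[OF W] by (simp_all add: \<kappa>_def)
  have "axis i 1 = gt 0 y i"
    using frame_identity[OF W, of i] by (simp add: n k mm gt_def f_def)
  from this[symmetric] show ?thesis by (simp add: axis_def)
qed

lemma F_zero_eq: "F 0 y = norm y"
  using F_eq'[OF zero_in_disk, of y] by (simp add: T_def D_def q_zero norm_eq_sqrt_inner)

text \<open>Over the origin the tensor is constant in y, so its y-gradient is 0. Hence a tangent
  vector that varies with the base point adds nothing to the first derivatives of the tensor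
  there.\<close>

lemma has_grads_gt_zero:
  assumes "y \<noteq> 0"
  shows "\<exists>u. has_grads (\<lambda>p y. gt p y i $ j) u 0 0 y"
proof -
  have W: "(0, y) \<in> W" using assms zero_in_disk by (simp add: W_def)
  obtain u v where uv: "has_grads (\<lambda>p y. gt p y i $ j) u v 0 y" using has_grads_gt[OF W] by blast
  have "partial_y k (\<lambda>p y. gt p y i $ j) 0 y = 0" for k
    unfolding partial_y_def
  proof (rule partialI)
    have "((\<lambda>y. if i = j then 1 else 0 :: real) has_derivative (\<lambda>h. 0)) (at y)" by simp
    thus "((\<lambda>y. gt 0 y i $ j) has_derivative (\<lambda>h. 0)) (at y)"
      by (rule has_derivative_transform_within_open[of _ _ _ _ "- {0}"]) (use assms in \<open>auto simp: gt_zero\<close>)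
  qed simp
  hence "v = 0" by (simp add: partial_y_eq[OF uv] vec_eq_iff)
  thus ?thesis using uv by blast
qed

lemma G_zero:
  assumes "y \<noteq> 0" and U: "\<And>i j. has_grads (\<lambda>p y. gt p y i $ j) (U i j) (V i j) 0 y"
  shows "G 0 y $ k = 1/4 * (\<Sum>i\<in>UNIV. \<Sum>j\<in>UNIV. (2 * U i k $ j - U i j $ k) * y $ i * y $ j)"
proof -
  have W: "(0, y) \<in> W" using assms zero_in_disk by (simp add: W_def)
  have ft: "fundamental_tensor F 0 y = mat 1"
    by (simp add: vec_eq_iff fundamental_tensor_eq[OF W] gt_zero[OF assms(1)] mat_def)
  have px: "partial_x k (\<lambda>p y. fundamental_tensor F p y $ i $ j) 0 y = U i j $ k" for i j k
    by (rule partial_x_eq[OF has_grads_cong[OF open_W W _ U]]) (simp add: fundamental_tensor_eq)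
  have inv: "matrix_inv (mat 1 :: real^2^2) = mat 1" by (rule matrix_inv_eqI) simp
  show ?thesis
    unfolding geodesic_coeff_eq[OF W, symmetric] geodesic_coeff_def px ft inv
    using exhaust_2[of k] by (auto simp: mat_def sum_2)
qed

section \<open>The fundamental tensor under a change of coordinates\<close>

lemma F_square_snd_derivative:
  assumes "(p, y) \<in> W"
  shows "((\<lambda>y. (F p y)\<^sup>2) has_derivative (\<lambda>h. (2 * F p y) *\<^sub>R f p y \<bullet> h)) (at y)"
    "((\<lambda>y. 2 * F p y * f p y $ i) has_derivative (\<lambda>h. 2 *\<^sub>R gt p y i \<bullet> h)) (at y)"
proof -
  show "((\<lambda>y. (F p y)\<^sup>2) has_derivative (\<lambda>h. (2 * F p y) *\<^sub>R f p y \<bullet> h)) (at y)"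
    by (rule has_grads_snd_derivative[OF has_grads_F_square[OF assms]])
  have "p \<in> disk \<rho>" "y \<noteq> 0" using assms by (auto simp: W_def)
  thus "((\<lambda>y. 2 * F p y * f p y $ i) has_derivative (\<lambda>h. 2 *\<^sub>R gt p y i \<bullet> h)) (at y)"
    by (intro has_derivative_transform_within_open[OF has_grads_snd_derivative[OF
            has_grads_partial_y_F_square[OF assms]], of "- {0}"])
       (auto simp: partial_y_eq[OF has_grads_F_square] W_def)
qed

text \<open>At a fixed point the new metric is F composed with the linear map L in the tangent
  variable, so the Hessian of its square transforms by congruence.\<close>

lemma fundamental_tensor_in_coordinates:
  fixes \<psi> :: "real^2 \<Rightarrow> real^2"
  assumes p: "\<psi> \<xi> \<in> disk \<rho>" and L: "L = frechet_derivative \<psi> (at \<xi>)"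
    and lin: "linear L" and inj: "inj L" and \<eta>: "\<eta> \<noteq> 0"
  shows "fundamental_tensor (in_coordinates \<psi> F) \<xi> \<eta> $ i $ j =
    (\<Sum>a\<in>UNIV. \<Sum>b\<in>UNIV. L (axis i 1) $ a * L (axis j 1) $ b * gt (\<psi> \<xi>) (L \<eta>) a $ b)"
proof -
  let ?p = "\<psi> \<xi>"
  have L0: "L \<eta> \<noteq> 0" if "\<eta> \<noteq> 0" for \<eta> using that linear_injective_0[OF lin] inj by blast
  have W: "(?p, L \<eta>) \<in> W" if "\<eta> \<noteq> 0" for \<eta> using p L0[OF that] by (simp add: W_def)
  have dL: "(L has_derivative L) (at \<eta>)" for \<eta>
    using lin by (simp add: linear_conv_bounded_linear bounded_linear_imp_has_derivative)
  have 1: "partial_y i (\<lambda>\<xi> \<eta>. (in_coordinates \<psi> F \<xi> \<eta>)\<^sup>2) \<xi> \<eta>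
      = (\<Sum>a\<in>UNIV. L (axis i 1) $ a * (2 * F ?p (L \<eta>) * f ?p (L \<eta>) $ a))" if "\<eta> \<noteq> 0" for \<eta> i
    unfolding partial_y_def in_coordinates_def L[symmetric]
    by (rule partialI[OF has_derivative_compose[OF dL F_square_snd_derivative(1)[OF W[OF that]]]])
       (simp add: inner_vec_def sum_2 algebra_simps)
  have "((\<lambda>\<eta>. \<Sum>a\<in>UNIV. L (axis i 1) $ a * (2 * F ?p (L \<eta>) * f ?p (L \<eta>) $ a)) has_derivative
      (\<lambda>h. \<Sum>a\<in>UNIV. L (axis i 1) $ a * (2 *\<^sub>R gt ?p (L \<eta>) a \<bullet> L h))) (at \<eta>)"
    by (intro has_derivative_sum has_derivative_mult_right
        has_derivative_compose[OF dL F_square_snd_derivative(2)[OF W[OF \<eta>]]])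
  hence 2: "(partial_y i (\<lambda>\<xi> \<eta>. (in_coordinates \<psi> F \<xi> \<eta>)\<^sup>2) \<xi> has_derivative
      (\<lambda>h. \<Sum>a\<in>UNIV. L (axis i 1) $ a * (2 *\<^sub>R gt ?p (L \<eta>) a \<bullet> L h))) (at \<eta>)"
    by (rule has_derivative_transform_within_open[of _ _ _ _ "- {0}"]) (use 1 \<eta> in auto)
  have "partial_y j (partial_y i (\<lambda>\<xi> \<eta>. (in_coordinates \<psi> F \<xi> \<eta>)\<^sup>2)) \<xi> \<eta> =
      (\<Sum>a\<in>UNIV. L (axis i 1) $ a * (2 *\<^sub>R gt ?p (L \<eta>) a \<bullet> L (axis j 1)))"
    unfolding partial_y_def[of j] by (rule partialI[OF 2 refl])
  thus ?thesis
    by (simp add: fundamental_tensor_def inner_vec_def sum_2 algebra_simps)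
qed

text \<open>At the origin the fundamental tensor is Euclidean and independent of \<open>y\<close>, so the second
  derivatives of a change of coordinates only add terms even in \<open>y\<close> to the spray. In projectively
  flat coordinates its odd part would be a multiple of \<open>y\<close>, but it contains
  \<open>- \<epsilon> \<bar>y\<bar> J y\<close>.\<close>

theorem not_projectively_flat:
  assumes \<epsilon>: "\<epsilon> \<noteq> 0"
  shows "\<not> locally_projectively_flat_on (disk \<rho>) F"
proof
  assume "locally_projectively_flat_on (disk \<rho>) F"
  from this[unfolded locally_projectively_flat_on_def, rule_format, OF zero_in_disk]
  obtain V \<phi> \<psi> P where V: "open V" "0 \<in> V" "V \<subseteq> disk \<rho>" and U: "open (\<phi> ` V)"
    and sm: "smooth_on V \<phi>" "smooth_on (\<phi> ` V) \<psi>" and inv: "\<And>x. x \<in> V \<Longrightarrow> \<psi> (\<phi> x) = x"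
    and flat: "\<And>\<xi> \<eta> i. \<xi> \<in> \<phi> ` V \<Longrightarrow> \<eta> \<noteq> 0 \<Longrightarrow>
      geodesic_coeff (in_coordinates \<psi> F) i \<xi> \<eta> = P \<xi> \<eta> * \<eta> $ i"
    by blast
  define M where "M \<xi> = frechet_derivative \<psi> (at \<xi>)" for \<xi>
  define \<xi>0 where "\<xi>0 = \<phi> 0"
  have xi0: "\<xi>0 \<in> \<phi> ` V" "\<psi> \<xi>0 = 0" using V(2) inv by (auto simp: \<xi>0_def)
  \<comment> \<open>One derivative gives the differential M, the second makes its columns N
    differentiable.\<close>
  have psi: "Ck_on (Suc (Suc 0)) \<psi> (\<phi> ` V)" using sm by (simp add: smooth_on_def)
  have dpsi: "(\<psi> has_derivative M \<xi>) (at \<xi>)" if "\<xi> \<in> \<phi> ` V" for \<xi>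
    unfolding M_def by (rule Ck_on_has_derivative[OF U psi that])
  have lin: "linear (M \<xi>)" if "\<xi> \<in> \<phi> ` V" for \<xi>
    using dpsi[OF that] by (rule has_derivative_linear)
  have surj: "surj (M \<xi>)" if "\<xi> \<in> \<phi> ` V" for \<xi>
  proof -
    from that obtain x where x: "\<xi> = \<phi> x" "x \<in> V" by (rule imageE)
    have "Ck_on (Suc 0) \<phi> V" using sm by (simp add: smooth_on_def)
    from Ck_on_has_derivative[OF V(1) this x(2)] dpsi[OF that]
    have "((\<lambda>x. \<psi> (\<phi> x)) has_derivative (\<lambda>h. M \<xi> (frechet_derivative \<phi> (at x) h))) (at x)"
      unfolding x(1) by (rule has_derivative_compose)
    hence "((\<lambda>x. x) has_derivative (\<lambda>h. M \<xi> (frechet_derivative \<phi> (at x) h))) (at x)"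
      by (rule has_derivative_transform_within_open[OF _ V(1) x(2)]) (simp add: inv)
    \<comment> \<open>Differentiating \<psi> (\<phi> x) = x gives a right inverse of M; surjectivity
      then implies injectivity in finite dimension.\<close>
    hence "(\<lambda>h. M \<xi> (frechet_derivative \<phi> (at x) h)) = (\<lambda>h. h)"
      by (rule has_derivative_unique) simp
    thus ?thesis by (metis surjI)
  qed
  have inj: "inj (M \<xi>)" if "\<xi> \<in> \<phi> ` V" for \<xi>
    by (rule linear_surjective_imp_injective[OF lin[OF that] surj[OF that] refl])
  define N where "N i \<xi> = M \<xi> (axis i 1)" for i :: 2 and \<xi>
  have "\<exists>N'. (N i has_derivative N') (at \<xi>0)" for i
  proof -
    have "Ck_on (Suc 0) (N i) (\<phi> ` V)" using psi unfolding N_def M_def by (simp add: Basis_vec_def)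
    thus ?thesis using Ck_on_has_derivative[OF U _ xi0(1)] by blast
  qed
  then obtain N' where N': "\<And>i. (N i has_derivative N' i) (at \<xi>0)" by metis
  have M_N: "M \<xi> \<eta> = (\<Sum>i\<in>UNIV. \<eta> $ i *\<^sub>R N i \<xi>)" if "\<xi> \<in> \<phi> ` V" for \<xi> \<eta>
    unfolding N_def by (rule linear_eq_sum_axis[OF lin[OF that]])
  define R where "R i = N i \<xi>0" for i
  \<comment> \<open>The k-th partial derivative of <N_i, N_j> at the image of the origin: the
    contribution of the second derivatives of the chart.\<close>
  define S where "S i j k = (\<Sum>a\<in>UNIV. N' i (axis k 1) $ a * R j $ a + R i $ a * N' j (axis k 1) $ a)" for i j k
  define g where "g = (\<chi> i j. R i \<bullet> R j)"
  have g_inv: "invertible g"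
  proof (rule pos_def_matrix_invertible)
    have "z \<bullet> (g *v z) = M \<xi>0 z \<bullet> M \<xi>0 z" for z
      unfolding M_N[OF xi0(1)] R_def[symmetric]
      by (simp add: g_def matrix_vector_mult_def inner_vec_def sum_2 algebra_simps)
    moreover have "M \<xi>0 z \<noteq> 0" if "z \<noteq> 0" for z
      using that linear_injective_0[OF lin[OF xi0(1)]] inj[OF xi0(1)] by blast
    ultimately show "pos_def_matrix g"
      by (simp add: pos_def_matrix_def g_def transpose_def vec_eq_iff inner_commute)
  qed
  \<comment> \<open>\<open>S\<close> does not depend on \<open>\<eta>\<close>, so it only contributes even terms.\<close>
  have key: "R k \<bullet> (P \<xi>0 \<eta> *\<^sub>R M \<xi>0 \<eta> - G 0 (M \<xi>0 \<eta>))
      = 1/4 * (\<Sum>i\<in>UNIV. \<Sum>j\<in>UNIV. (2 * S i k j - S i j k) * \<eta> $ i * \<eta> $ j)"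
    if \<eta>: "\<eta> \<noteq> 0" for \<eta> k
  proof -
    define y where "y = M \<xi>0 \<eta>"
    have y: "y = (\<Sum>i\<in>UNIV. \<eta> $ i *\<^sub>R R i)" unfolding y_def R_def by (rule M_N[OF xi0(1)])
    have y0: "y \<noteq> 0" unfolding y_def using \<eta> linear_injective_0[OF lin[OF xi0(1)]] inj[OF xi0(1)] by blast
    obtain u where u: "\<And>a b. has_grads (\<lambda>p y. gt p y a $ b) (u a b) 0 0 y"
      using has_grads_gt_zero[OF y0] by metis
    have ft: "fundamental_tensor (in_coordinates \<psi> F) \<xi> \<eta> $ i $ j =
      (\<Sum>a\<in>UNIV. \<Sum>b\<in>UNIV. N i \<xi> $ a * N j \<xi> $ b * gt (\<psi> \<xi>) (M \<xi> \<eta>) a $ b)" if "\<xi> \<in> \<phi> ` V" for \<xi> i j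
      unfolding N_def
      by (rule fundamental_tensor_in_coordinates[OF _ M_def lin[OF that] inj[OF that] \<eta>])
         (use that inv V(3) in auto)
    have "fundamental_tensor (in_coordinates \<psi> F) \<xi>0 \<eta> = g"
      unfolding vec_eq_iff ft[OF xi0(1)]
      by (simp add: xi0(2) y_def[symmetric] gt_zero[OF y0] g_def R_def[symmetric] inner_vec_def sum_2)
    note ft0 = this
    have dM: "((\<lambda>\<xi>. M \<xi> \<eta>) has_derivative (\<lambda>h. \<Sum>i\<in>UNIV. \<eta> $ i *\<^sub>R N' i h)) (at \<xi>0)"
    proof (rule has_derivative_transform_within_open[OF _ U xi0(1)])
      show "((\<lambda>\<xi>. \<Sum>i\<in>UNIV. \<eta> $ i *\<^sub>R N i \<xi>) has_derivative (\<lambda>h. \<Sum>i\<in>UNIV. \<eta> $ i *\<^sub>R N' i h)) (at \<xi>0)"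
        by (intro has_derivative_sum has_derivative_scaleR_right N')
    qed (simp add: M_N)
    \<comment> \<open>Only the motion of the base point contributes, as the y-gradient of the tensor
      is 0 over the origin.\<close>
    have dgt: "((\<lambda>\<xi>. gt (\<psi> \<xi>) (M \<xi> \<eta>) a $ b) has_derivative (\<lambda>h. u a b \<bullet> M \<xi>0 h)) (at \<xi>0)" for a b
      using has_derivative_compose[OF has_derivative_Pair[OF dpsi[OF xi0(1)] dM],
         of "\<lambda>z. gt (fst z) (snd z) a $ b" "\<lambda>h. u a b \<bullet> fst h"] u[of a b]
      unfolding has_grads_def by (simp add: xi0(2) y_def)
    have px: "partial_x k (\<lambda>\<xi> \<eta>. fundamental_tensor (in_coordinates \<psi> F) \<xi> \<eta> $ i $ j) \<xi>0 \<eta>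
      = S i j k + (\<Sum>a\<in>UNIV. \<Sum>b\<in>UNIV. R i $ a * R j $ b * (u a b \<bullet> R k))" for i j k
    proof -
      have dN: "((\<lambda>\<xi>. N i \<xi> $ a) has_derivative (\<lambda>h. N' i h $ a)) (at \<xi>0)" for i a
        by (rule bounded_linear.has_derivative[OF bounded_linear_vec_nth N'])
      have "((\<lambda>\<xi>. \<Sum>a\<in>UNIV. \<Sum>b\<in>UNIV. N i \<xi> $ a * N j \<xi> $ b * gt (\<psi> \<xi>) (M \<xi> \<eta>) a $ b) has_derivative
        (\<lambda>h. \<Sum>a\<in>UNIV. \<Sum>b\<in>UNIV. N i \<xi>0 $ a * N j \<xi>0 $ b * (u a b \<bullet> M \<xi>0 h)
          + (N i \<xi>0 $ a * N' j h $ b + N' i h $ a * N j \<xi>0 $ b) * gt (\<psi> \<xi>0) (M \<xi>0 \<eta>) a $ b)) (at \<xi>0)"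
        by (intro has_derivative_sum has_derivative_mult dN dgt)
      hence "((\<lambda>\<xi>. fundamental_tensor (in_coordinates \<psi> F) \<xi> \<eta> $ i $ j) has_derivative
        (\<lambda>h. \<Sum>a\<in>UNIV. \<Sum>b\<in>UNIV. N i \<xi>0 $ a * N j \<xi>0 $ b * (u a b \<bullet> M \<xi>0 h)
          + (N i \<xi>0 $ a * N' j h $ b + N' i h $ a * N j \<xi>0 $ b) * gt (\<psi> \<xi>0) (M \<xi>0 \<eta>) a $ b)) (at \<xi>0)"
        by (rule has_derivative_transform_within_open[OF _ U xi0(1)]) (simp add: ft)
      thus ?thesis unfolding partial_x_def
        by (rule partialI)
           (simp add: xi0(2) y_def[symmetric] gt_zero[OF y0] S_def R_def[symmetric] N_def[symmetric] sum_2 algebra_simps)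
    qed
    define e where "e k = 1/4 * (\<Sum>i\<in>UNIV. \<Sum>j\<in>UNIV.
      (2 * (S i k j + (\<Sum>a\<in>UNIV. \<Sum>b\<in>UNIV. R i $ a * R k $ b * (u a b \<bullet> R j)))
        - (S i j k + (\<Sum>a\<in>UNIV. \<Sum>b\<in>UNIV. R i $ a * R j $ b * (u a b \<bullet> R k)))) * \<eta> $ i * \<eta> $ j)" for k
    have "geodesic_coeff (in_coordinates \<psi> F) i \<xi>0 \<eta> = (matrix_inv g *v vec_lambda e) $ i" for i
      unfolding geodesic_coeff_def px ft0 e_def matrix_vector_mult_def
      by (simp add: sum_2 algebra_simps)
    hence "matrix_inv g *v vec_lambda e = P \<xi>0 \<eta> *\<^sub>R \<eta>"
      by (simp add: vec_eq_iff flat[OF xi0(1) \<eta>])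
    hence "g *v (matrix_inv g *v vec_lambda e) = P \<xi>0 \<eta> *\<^sub>R (g *v \<eta>)"
      by (simp add: matrix_vector_mult_scaleR)
    moreover have "g ** matrix_inv g = mat 1"
      using someI_ex[OF g_inv[unfolded invertible_def]] by (simp add: matrix_inv_def)
    ultimately have "vec_lambda e = P \<xi>0 \<eta> *\<^sub>R (g *v \<eta>)" by (simp add: matrix_vector_mul_assoc)
    hence "e k = P \<xi>0 \<eta> * (g *v \<eta>) $ k" by (simp add: vec_eq_iff)
    also have "(g *v \<eta>) $ k = R k \<bullet> y"
      by (simp add: y g_def matrix_vector_mult_def sum_2 inner_add_right mult.commute)
    finally have e1: "e k = P \<xi>0 \<eta> * (R k \<bullet> y)" .
    \<comment> \<open>The terms in u are the spray of \<open>F\<close> at the origin paired with the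
      column R_k, by \<open>G_zero\<close>; the terms in S remain separate.\<close>
    have "e k = 1/4 * (\<Sum>i\<in>UNIV. \<Sum>j\<in>UNIV. (2 * S i k j - S i j k) * \<eta> $ i * \<eta> $ j) + R k \<bullet> G 0 y"
      unfolding e_def inner_vec_def[of "R k" "G 0 y"] inner_real_def G_zero[OF y0 u]
      by (simp add: y inner_vec_def sum_2 algebra_simps)
    thus ?thesis using e1 by (simp add: y_def[symmetric] inner_diff_right)
  qed
  define \<eta> :: "real^2" where "\<eta> = axis 1 1"
  define y where "y = M \<xi>0 \<eta>"
  have \<eta>: "\<eta> \<noteq> 0" by (simp add: \<eta>_def axis_eq_0_iff)
  have y0: "y \<noteq> 0" unfolding y_def using \<eta> linear_injective_0[OF lin[OF xi0(1)]] inj[OF xi0(1)] by blast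
  have y': "M \<xi>0 (- \<eta>) = - y" unfolding y_def using lin[OF xi0(1)] by (simp add: linear_neg)
  \<comment> \<open>The quadratic right-hand side of \<open>key\<close> agrees at \<eta> and -
    \<eta>, so this difference is orthogonal to every column R_k. The columns span the plane, and d
    vanishes.\<close>
  define d where "d = (P \<xi>0 \<eta> *\<^sub>R y - G 0 y) - (P \<xi>0 (- \<eta>) *\<^sub>R (- y) - G 0 (- y))"
  have "R k \<bullet> d = 0" for k
    unfolding d_def inner_diff_right[of "R k" "_ - _" "_ - _"]
    using key[OF \<eta>, of k] key[of "- \<eta>" k] \<eta> by (simp add: y_def[symmetric] y')
  hence "d \<bullet> M \<xi>0 h = 0" for h
    unfolding M_N[OF xi0(1)] R_def[symmetric] by (simp add: inner_sum_right inner_commute)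
  moreover obtain h where "M \<xi>0 h = d" using surj[OF xi0(1)] by (metis surjE)
  ultimately have "d = 0" by (metis inner_eq_zero_iff)
  \<comment> \<open>Pairing with J y removes the unknown multiples P of y and keeps the odd part of
    the spray.\<close>
  hence "d \<bullet> v_field y = 0" by simp
  moreover have "G 0 y \<bullet> v_field y = - \<epsilon> * norm y * (y \<bullet> y)" for y
    by (simp add: G_def q_zero F_zero_eq inner_diff_left inner_v_field_self inner_v_field_v_field)
  from this[of y] this[of "- y"]
  have "d \<bullet> v_field y = 2 * \<epsilon> * norm y * (y \<bullet> y)"
    using v_field_scaleR[of "-1" y]
    by (simp add: d_def inner_diff_left inner_v_field_self)
  ultimately show False using \<epsilon> y0 by simp
qed

end

theorem theorem1p3:
  fixes \<epsilon> \<rho> :: real and F :: "real^2 \<Rightarrow> real^2 \<Rightarrow> real"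
  assumes rho: "\<rho> = 1 / sqrt (1 + \<epsilon>\<^sup>2)"
    and F_zero: "\<And>p. p \<in> disk \<rho> \<Longrightarrow> F p 0 = 0"
    and F_pos: "\<And>p y. p \<in> disk \<rho> \<Longrightarrow> y \<noteq> 0 \<Longrightarrow> F p y > 0"
    and F_eq: "\<And>p y w. p \<in> disk \<rho> \<Longrightarrow> y \<noteq> 0 \<Longrightarrow> w = (1 / F p y) *\<^sub>R y - \<epsilon> *\<^sub>R v_field p \<Longrightarrow>
                 sqrt (klein_metric p w w) + klein_metric p (u_field p) w = 1"
  shows "\<exists>a b. randers_metric_on (disk \<rho>) F a b \<and>
           constant_curvature_on (disk \<rho>) F (- 1/4) \<and>
           (\<forall>p\<in>disk \<rho>. \<forall>y. y \<noteq> 0 \<longrightarrow> S_curvature F p y = 3/2 * F p y) \<and>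
           (\<epsilon> \<noteq> 0 \<longrightarrow> \<not> locally_projectively_flat_on (disk \<rho>) F) \<and>
           (\<epsilon> \<noteq> 0 \<longrightarrow> \<not> gauss_curvature a constant_on disk \<rho>) \<and>
           (\<epsilon> = 0 \<longrightarrow> (\<forall>p\<in>disk \<rho>. gauss_curvature a p = - 1))"
proof -
  interpret tf: twisted_funk \<epsilon> \<rho> F
  proof
    fix p y :: "real^2"
    assume p: "p \<in> disk \<rho>"
    show "F p y = (twist \<epsilon> p \<bullet> y + sqrt ((twist \<epsilon> p \<bullet> y)\<^sup>2 + (1 - twist \<epsilon> p \<bullet> twist \<epsilon> p) * (y \<bullet> y)))
        / (1 - twist \<epsilon> p \<bullet> twist \<epsilon> p)"
    \<comment> \<open>The defining equation speaks only of nonzero vectors; at 0 the formula agrees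
      with the convention F 0 = 0.\<close>
    proof (cases "y = 0")
      case True
      thus ?thesis by (simp add: F_zero[OF p])
    next
      case False
      show ?thesis
        using F_eq[OF p False refl]
        by (intro funk_metric_root p[unfolded rho] F_pos p False) (simp add: funk_metric_def)
    qed
  qed (rule rho)
  have "\<not> gauss_curvature tf.a constant_on disk \<rho>" if \<epsilon>: "\<epsilon> \<noteq> 0"
  proof
    assume "gauss_curvature tf.a constant_on disk \<rho>"
    then obtain K where K: "gauss_curvature tf.a p = K" if "p \<in> disk \<rho>" for p
      unfolding constant_on_def by blast
    \<comment> \<open>At half the radius |q|^2 = 1/4 and D = 3/4, against D = 1 at the origin, so
      the two curvatures differ by 2 \<epsilon>^2.\<close>
    define p :: "real^2" where "p = vector [\<rho> / 2, 0]"
    have e: "1 + \<epsilon>\<^sup>2 > 0" by (smt (verit) zero_le_power2)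
    have Dp: "tf.D p = 3/4" "tf.D 0 = 1"
      using e by (simp_all add: tf.D_def twist_inner p_def rho power_divide)
    hence "p \<in> disk \<rho>" "0 \<in> disk \<rho>" by (simp_all add: tf.disk_iff)
    from this[THEN tf.gauss_curvature_a] this[THEN K] \<epsilon> show False by (simp add: Dp)
  qed
  moreover have "gauss_curvature tf.a p = - 1" if "\<epsilon> = 0" "p \<in> disk \<rho>" for p
    using tf.gauss_curvature_a[OF that(2)] that(1) by simp
  ultimately show ?thesis
    using tf.randers_metric tf.constant_curvature tf.S_curvature_eq tf.not_projectively_flat
    by (intro exI[of _ tf.a] exI[of _ tf.b]) (auto simp: tf.W_def)
qed

end
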